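(* (Alternative statement of the Prime Number Theorem) Let $\vartheta(x) = \sum_{p\le x}\log p$ for real $x \ge 0$ (sum over primes $p$). Then $\vartheta(x) \sim x$ as $x \to \infty$, that is, $$\lim_{x\to\infty}\frac{\vartheta(x)}{x} = 1.$$
   Context: For each real $x \ge 0$, $\vartheta(x) = \sum_{p\le x}\log p$, the sum running over primes $p$ (the Chebyshev theta function). $\log$ is the natural logarithm. For functions $f,g$ of a real variable, $g(x)\sim f(x)$ means $\lim_{x\to\infty} f(x)/g(x) = 1$. *)

theory Defs
  imports
    Complex_Main
    "HOL-Computational_Algebra.Primes"
    "HOL-Library.Landau_Symbols"
begin

text \<open>
  The Chebyshev theta function. The index set is finite for every real \<open>x\<close>
  (and empty for \<open>x < 2\<close>, so negative arguments yield \<open>0\<close>).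
\<close>

definition chebyshev_theta :: "real \<Rightarrow> real" where
  "chebyshev_theta x = (\<Sum>p | prime (p::nat) \<and> real p \<le> x. ln (real p))"

end

theory Submission
  imports
    Defs
    "HOL-Complex_Analysis.Complex_Analysis"
    "HOL-Number_Theory.Prime_Powers"
    "HOL-Real_Asymp.Real_Asymp"
begin

text \<open>
  The argument is Newman's. With \<open>\<psi>\<close> the summatory function of the von Mangoldt function \<open>\<Lambda>\<close>, the
  Laplace transform of the bounded function \<open>\<psi>(e\<^sup>t) / e\<^sup>t - 1\<close> is
  \<open>P(z + 1) / (z + 1) - 1 / z\<close>, where \<open>P = - \<zeta>' / \<zeta>\<close> is the Dirichlet series of \<open>\<Lambda>\<close>. Since \<open>\<zeta>\<close> has a
  simple pole at 1 and no zeros on \<open>Re s \<ge> 1\<close> (by the inequality \<open>3 + 4 cos x + cos 2x \<ge> 0\<close>), this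
  transform extends holomorphically past \<open>Re z = 0\<close>. A contour integral then shows that the integral of
  the function itself converges, and as \<open>\<psi>\<close> is monotone this is only possible if \<open>\<psi>(x) / x\<close> tends
  to 1. Finally \<open>\<psi>\<close> and \<open>\<vartheta>\<close> differ only by the contribution of the proper prime powers, which is
  \<open>O(sqrt x log\<^sup>2 x)\<close>.
\<close>

section \<open>Newman's Tauberian theorem\<close>

text \<open>Newman's argument needs a bounded function, so the estimate psi(x) = O(x) has to come
  first; it is extracted from factorials and central binomial coefficients. The transform is
  truncated at \<open>T\<close>. Each truncation is entire, and \<open>newman_tauberian\<close> asks
  only for such a family \<open>g T\<close> with two bounds that may blow up like
  \<open>1 / Re z\<close>; no integral enters its statement. Its conclusion at 0 then becomes the
  convergence of an explicit sum over \<open>n \<le> exp T\<close>. On the zeta side the pole is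
  removed at the outset: \<open>zeta_cleared\<close> is \<open>(s - 1) * zeta(s)\<close>,
  holomorphic for \<open>Re s > 0\<close>, with value 1 at 1. Zeros are detected through the residue
  of the logarithmic derivative, a natural number that is compared with the behaviour of
  \<open>dirichlet mangoldt\<close>. This one criterion serves both \<open>Re s > 1\<close>, where
  that series is continuous, and the line \<open>Re s = 1\<close>, where positivity limits the size
  of the residue.\<close>

definition right_arc :: "real \<Rightarrow> real \<Rightarrow> complex" where
  "right_arc R = part_circlepath 0 R (-(pi/2)) (pi/2)"

lemma valid_path_right_arc [simp]: "valid_path (right_arc R)"
  by (simp add: right_arc_def)

lemma right_arc_ends [simp]:
  "pathstart (right_arc R) = -(\<i> * of_real R)" "pathfinish (right_arc R) = \<i> * of_real R"
  by (simp_all add: right_arc_def exp_eq_polar cis.ctr complex_eq_iff flip: cis_conv_exp)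

lemma right_arc_image:
  assumes "R > 0" "w \<in> path_image (right_arc R)"
  shows "norm w = R" "Re w \<ge> 0"
proof -
  show "norm w = R"
    using in_path_image_part_circlepath[OF assms(2)[unfolded right_arc_def]] assms(1) by simp
  obtain x where x: "-(pi/2) \<le> x" "x \<le> pi/2" "w = R * exp (\<i> * of_real x)"
    using assms(2) unfolding right_arc_def by (subst (asm) path_image_part_circlepath) auto
  then show "Re w \<ge> 0"
    using assms(1) by (simp add: Re_exp cos_ge_zero)
qed

text \<open>On the arc \<open>Ln w\<close> is a primitive of \<open>1 / w\<close>, and on
  \<open>\<eta>\<close> so is \<open>Ln (-w)\<close>, because each path avoids the relevant branch
  cut; each half contributes \<open>\<i> * pi\<close>. Leaving \<open>\<eta>\<close> arbitrary in
  the left half plane lets the lemma serve the half circle and the polygon alike.\<close>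

lemma half_circle_winding:
  assumes R: "R > 0"
    and \<eta>: "valid_path \<eta>" "pathstart \<eta> = \<i> * of_real R" "pathfinish \<eta> = -(\<i> * of_real R)"
    and left: "\<And>w. w \<in> path_image \<eta> \<Longrightarrow> Re w \<le> 0" and "0 \<notin> path_image \<eta>"
  shows "winding_number (right_arc R +++ \<eta>) 0 = 1"
proof -
  have LnR: "Ln (\<i> * of_real R) = of_real (ln R) + \<i> * of_real (pi/2)"
            "Ln (-(\<i> * of_real R)) = of_real (ln R) - \<i> * of_real (pi/2)"
    using Ln_times_of_real[OF R, of "\<i>"] Ln_times_of_real[OF R, of "-\<i>"] R
    by (simp_all add: mult.commute Ln_of_real)
  have pos: "w \<notin> \<real>\<^sub>\<le>\<^sub>0" if "w \<noteq> 0" "Re w \<ge> 0" for w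
    using that by (auto simp: complex_nonpos_Reals_iff complex_eq_iff)
  have "((\<lambda>w. 1 / w) has_contour_integral
          (Ln (pathfinish (right_arc R)) - Ln (pathstart (right_arc R)))) (right_arc R)"
  proof (rule contour_integral_primitive)
    fix x assume "x \<in> path_image (right_arc R)"
    then have "x \<notin> \<real>\<^sub>\<le>\<^sub>0"
      using right_arc_image[OF R] R pos by force
    then show "(Ln has_field_derivative 1 / x) (at x within path_image (right_arc R))"
      by (auto intro!: derivative_eq_intros simp: field_simps)
  qed auto
  then have 1: "((\<lambda>w. 1 / w) has_contour_integral \<i> * pi) (right_arc R)"
    unfolding right_arc_ends LnR by (simp add: field_simps)
  have "((\<lambda>w. 1 / w) has_contour_integral (Ln (- pathfinish \<eta>) - Ln (- pathstart \<eta>))) \<eta>"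
  proof (rule contour_integral_primitive)
    fix x assume "x \<in> path_image \<eta>"
    then have "-x \<notin> \<real>\<^sub>\<le>\<^sub>0"
      using left[of x] \<open>0 \<notin> path_image \<eta>\<close> by (intro pos) auto
    then show "((\<lambda>x. Ln (- x)) has_field_derivative 1 / x) (at x within path_image \<eta>)"
      by (auto intro!: derivative_eq_intros simp: field_simps)
  qed (use \<eta> in auto)
  then have 2: "((\<lambda>w. 1 / w) has_contour_integral \<i> * pi) \<eta>"
    unfolding \<eta> minus_minus LnR by (simp add: field_simps)
  have "((\<lambda>w. 1 / w) has_contour_integral \<i> * pi + \<i> * pi) (right_arc R +++ \<eta>)"
    using 1 2 \<eta> by (intro has_contour_integral_join) auto
  moreover have "0 \<notin> path_image (right_arc R +++ \<eta>)"
    using right_arc_image[OF R, of 0] R \<open>0 \<notin> path_image \<eta>\<close> \<eta>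
    by (auto simp: path_image_join right_arc_ends)
  ultimately show ?thesis
    using \<eta> by (subst winding_number_valid_path)
      (auto simp: contour_integral_unique right_arc_ends)
qed

text \<open>Used twice in Newman's proof: with a box reaching slightly left of the imaginary axis as
  \<open>S\<close> for \<open>G\<close>, and with \<open>S = UNIV\<close> for \<open>g T\<close>.
  Convexity of \<open>S\<close> gives Cauchy's formula without a homotopy argument.\<close>

lemma half_circle_formula:
  assumes R: "R > 0"
    and \<eta>: "valid_path \<eta>" "pathstart \<eta> = \<i> * of_real R" "pathfinish \<eta> = -(\<i> * of_real R)"
    and left: "\<And>w. w \<in> path_image \<eta> \<Longrightarrow> Re w \<le> 0" and "0 \<notin> path_image \<eta>"
    and S: "convex S" "open S" "0 \<in> S" "path_image (right_arc R) \<subseteq> S" "path_image \<eta> \<subseteq> S"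
    and f: "f holomorphic_on S"
  shows "(\<lambda>w. f w / w) contour_integrable_on right_arc R"
    and "(\<lambda>w. f w / w) contour_integrable_on \<eta>"
    and "contour_integral (right_arc R) (\<lambda>w. f w / w) + contour_integral \<eta> (\<lambda>w. f w / w)
           = 2 * pi * \<i> * f 0"
proof -
  have 0: "0 \<notin> path_image (right_arc R)"
    using right_arc_image[OF R, of 0] R by auto
  have hol: "(\<lambda>w. f w / w) holomorphic_on S - {0}"
    using f by (auto intro!: holomorphic_intros elim: holomorphic_on_subset)
  have opn: "open (S - {0})"
    using S by auto
  show i1: "(\<lambda>w. f w / w) contour_integrable_on right_arc R"
    using 0 S by (intro contour_integrable_holomorphic_simple[OF hol opn]) auto
  show i2: "(\<lambda>w. f w / w) contour_integrable_on \<eta>"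
    using \<eta> \<open>0 \<notin> path_image \<eta>\<close> S 
    by (intro contour_integrable_holomorphic_simple[OF hol opn]) auto
  have "((\<lambda>w. f w / (w - 0)) has_contour_integral
           (2 * pi * \<i> * winding_number (right_arc R +++ \<eta>) 0 * f 0)) (right_arc R +++ \<eta>)"
    using S \<eta> f 0 \<open>0 \<notin> path_image \<eta>\<close>
    by (intro Cauchy_integral_formula_convex_simple[where S = S])
       (auto simp: right_arc_ends path_image_join interior_open)
  then have "contour_integral (right_arc R +++ \<eta>) (\<lambda>w. f w / w) = 2 * pi * \<i> * f 0"
    using half_circle_winding[OF assms(1-6)] by (auto dest: contour_integral_unique)
  then show "contour_integral (right_arc R) (\<lambda>w. f w / w) + contour_integral \<eta> (\<lambda>w. f w / w)
           = 2 * pi * \<i> * f 0"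
    using i1 i2 \<eta> by simp
qed

text \<open>Since \<open>z * cnj z = R^2\<close> on the circle, \<open>1 + z^2 / R^2\<close> equals
  \<open>z * (cnj z + z) / R^2\<close>, that is \<open>z * 2 * Re z / R^2\<close>. This is the
  origin of the factor that compensates a bound of size \<open>1 / Re z\<close>.\<close>

lemma newman_kernel_norm:
  assumes "norm z = R" "R > 0"
  shows "norm (exp (of_real T * z) * (1 + z\<^sup>2 / of_real (R\<^sup>2)) / z) = 2 * \<bar>Re z\<bar> * exp (T * Re z) / R\<^sup>2"
proof -
  have "z * cnj z = of_real (R\<^sup>2)"
    using assms complex_norm_square[of z] by simp
  then have "1 + z\<^sup>2 / of_real (R\<^sup>2) = z * of_real (2 * Re z) / of_real (R\<^sup>2)"
    using assms arg_cong[OF complex_add_cnj[of z], of "\<lambda>w. z * w"]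
    by (simp add: field_simps power2_eq_square)
  then have "norm (1 + z\<^sup>2 / of_real (R\<^sup>2)) = R * (2 * \<bar>Re z\<bar>) / R\<^sup>2"
    using assms by (simp add: norm_mult norm_divide norm_power)
  then show ?thesis
    using assms by (simp add: norm_mult norm_divide)
qed

text \<open>The decay of \<open>exp (T * z)\<close> is not uniform, as it is lost at the end
  \<open>b\<close> on the imaginary axis. But at parameter \<open>x\<close> its modulus is
  \<open>exp (- c * T * (1 - x))\<close>, and integrating this over \<open>x\<close> gives at most
  \<open>1 / (c * T)\<close>.\<close>

lemma contour_integral_decay:
  assumes h: "continuous_on (closed_segment a b) h" and a: "Re a < 0" and b: "Re b = 0"
  shows "((\<lambda>T. contour_integral (linepath a b) (\<lambda>z. h z * exp (of_real T * z))) \<longlongrightarrow> 0) at_top"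
proof -
  have "compact (h ` closed_segment a b)"
    by (intro compact_continuous_image h compact_segment)
  then obtain M where M: "M > 0" "\<And>z. z \<in> closed_segment a b \<Longrightarrow> norm (h z) \<le> M"
    using bounded_pos[of "h ` closed_segment a b"] compact_imp_bounded by auto
  define c where "c = - Re a"
  have c: "c > 0" using a by (simp add: c_def)
  define D where "D = M * norm (b - a)"
  have bound: "norm (contour_integral (linepath a b) (\<lambda>z. h z * exp (of_real T * z))) \<le> D / (c * T)"
    if T: "T > 0" for T
  proof -
    have cont: "continuous_on (closed_segment a b) (\<lambda>z. h z * exp (of_real T * z))"
      by (intro continuous_intros h)
    have "((\<lambda>x. h (linepath a b x) * exp (of_real T * linepath a b x) * (b - a)) has_integral
            contour_integral (linepath a b) (\<lambda>z. h z * exp (of_real T * z))) {0..1}"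
      using has_contour_integral_integral[OF contour_integrable_continuous_linepath[OF cont]]
      by (simp add: has_contour_integral_linepath)
    note 1 = this
    have 2: "((\<lambda>x. D * exp (- c * T * (1 - x))) has_integral
                     (D / (c * T) * exp (- c * T * (1 - 1)) - D / (c * T) * exp (- c * T * (1 - 0)))) {0..1}"
      using c T by (intro fundamental_theorem_of_calculus)
        (auto intro!: derivative_eq_intros simp flip: has_real_derivative_iff_has_vector_derivative)
    have "norm (contour_integral (linepath a b) (\<lambda>z. h z * exp (of_real T * z)))
        \<le> (D / (c * T) * exp (- c * T * (1 - 1)) - D / (c * T) * exp (- c * T * (1 - 0)))"
    unfolding 1[THEN integral_unique, symmetric] 2[THEN integral_unique, symmetric]
    proof (rule integral_norm_bound_integral[OF has_integral_integrable[OF 1] has_integral_integrable[OF 2]])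
      fix x :: real assume x: "x \<in> {0..1}"
      have re: "T * Re (linepath a b x) = - c * T * (1 - x)"
        using b by (simp add: linepath_def c_def algebra_simps)
      have "norm (h (linepath a b x) * exp (of_real T * linepath a b x) * (b - a))
          = norm (h (linepath a b x)) * exp (- c * T * (1 - x)) * norm (b - a)"
        by (simp add: norm_mult re del: of_real_mult)
      also have "\<dots> \<le> M * exp (- c * T * (1 - x)) * norm (b - a)"
        using x by (intro M linepath_in_path mult_right_mono) auto
      finally show "norm (h (linepath a b x) * exp (of_real T * linepath a b x) * (b - a))
          \<le> D * exp (- c * T * (1 - x))"
        by (simp add: D_def mult_ac)
    qed
    also have "\<dots> \<le> D / (c * T)"
      using M c T by (simp add: D_def)
    finally show ?thesis .
  qed
  have "((\<lambda>T. D / (c * T)) \<longlongrightarrow> 0) at_top"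
    using c by (intro tendsto_divide_0[OF tendsto_const] filterlim_at_top_imp_at_infinity
       filterlim_tendsto_pos_mult_at_top[OF tendsto_const] filterlim_ident)
  then show ?thesis
    by (rule Lim_null_comparison[rotated])
       (use bound in \<open>auto intro: eventually_mono[OF eventually_gt_at_top[of 0]]\<close>)
qed

text \<open>
  Both \<open>G\<close> and \<open>g T\<close> are evaluated at 0 by Cauchy's formula with the kernel \<open>e\<^sup>T\<^sup>z (1 + z\<^sup>2 / R\<^sup>2) / z\<close>. The
  contours share the right half of the circle of radius \<open>R\<close>; to the left, \<open>g T\<close> is integrated over the
  other half circle, but \<open>G\<close> over a shallow polygon inside its domain. On the circle the kernel
  cancels the singularity at \<open>Re z = 0\<close> of the two bounds, which leaves an error \<open>O(B / R)\<close>.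
\<close>

lemma newman_tauberian:
  fixes G :: "complex \<Rightarrow> complex" and g :: "real \<Rightarrow> complex \<Rightarrow> complex"
  assumes U: "open U" "{z. Re z \<ge> 0} \<subseteq> U" and G: "G holomorphic_on U"
    and g: "\<And>T. T \<ge> 0 \<Longrightarrow> g T holomorphic_on UNIV"
    and right: "\<And>T z. T \<ge> 0 \<Longrightarrow> Re z > 0 \<Longrightarrow> norm (G z - g T z) \<le> B * exp (-(T * Re z)) / Re z"
    and left: "\<And>T z. T \<ge> 0 \<Longrightarrow> Re z < 0 \<Longrightarrow> norm (g T z) \<le> B * exp (-(T * Re z)) / (- Re z)"
  shows "((\<lambda>T. g T 0) \<longlongrightarrow> G 0) at_top"
proof (rule tendstoI)
  fix \<epsilon> :: real assume \<epsilon>: "\<epsilon> > 0"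
  have B: "B \<ge> 0"
    using right[of 0 1] by (simp add: order.trans[OF norm_ge_zero])
  \<comment> \<open>The two half circles will contribute at most \<open>4 * B / R * pi\<close> to
    \<open>2 * pi * norm (G 0 - g T 0)\<close>. This radius makes that less than
    \<open>\<epsilon> * pi\<close>, leaving another \<open>\<epsilon> * pi\<close> for the polygon;
    the summand 1 keeps \<open>R\<close> positive when \<open>B = 0\<close>.\<close>
  define R where "R = 4 * B / \<epsilon> + 1"
  have R: "R > 0" and "4 * B / R < \<epsilon>"
    using B \<epsilon> by (simp_all add: R_def field_simps add_pos_nonneg)
  \<comment> \<open>Compactness of this segment gives one width \<open>e\<close> by which
    \<open>U\<close> extends to the left along all of it. It overshoots the arc by 1 at both ends so
    that the ends of the contour lie inside the open box \<open>S\<close>.\<close>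
  define K where "K = closed_segment (Complex 0 (-(R + 1))) (Complex 0 (R + 1))"
  have K: "z \<in> K" if "Re z = 0" "\<bar>Im z\<bar> \<le> R + 1" for z
    using that R by (auto simp: K_def closed_segment_same_Re closed_segment_eq_real_ivl)
  have "Re z = 0" if "z \<in> K" for z
    using that by (auto simp: K_def closed_segment_same_Re)
  then have "K \<subseteq> U"
    using U by auto
  then obtain e where e: "e > 0" "(\<Union>z\<in>K. cball z e) \<subseteq> U"
    using compact_subset_open_imp_cball_epsilon_subset[OF compact_segment[folded K_def] U(1)] K_def by metis
  define S where "S = {z. Re z > - e} \<inter> {z. Im z < R + 1} \<inter> {z. Im z > -(R + 1)}"
  have S: "convex S" "open S" "0 \<in> S"
    unfolding S_def using e R
    by (auto intro!: convex_Int convex_halfspace_Re_gt convex_halfspace_Im_lt convex_halfspace_Im_gt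
          open_Int open_halfspace_Re_gt open_halfspace_Im_lt open_halfspace_Im_gt)
  have "S \<subseteq> U"
  proof
    fix z assume z: "z \<in> S"
    show "z \<in> U"
    proof (cases "Re z \<ge> 0")
      case False
      have "Complex 0 (Im z) \<in> K"
        using z by (intro K) (auto simp: S_def)
      moreover have "z \<in> cball (Complex 0 (Im z)) e"
        using z False by (simp add: dist_norm S_def cmod_def)
      ultimately show ?thesis
        using e by blast
    qed (use U in auto)
  qed
  \<comment> \<open>The polygon runs from \<open>b\<close> to \<open>- b\<close> through
    \<open>a\<close>, at half the available depth, so it passes to the left of 0 and stays in
    \<open>S\<close>.\<close>
  define a :: complex where "a = of_real (-(e/2))"
  define b where "b = \<i> * of_real R"
  define \<eta> where "\<eta> = linepath b a +++ linepath a (-b)"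
  define \<gamma> where "\<gamma> = part_circlepath 0 R (pi/2) (3*pi/2)"
  have neg: "Re w \<le> 0 \<and> w \<noteq> 0 \<and> w \<in> S" if "w \<in> closed_segment a b \<or> w \<in> closed_segment a (-b)" for w
  proof -
    obtain u :: real where u: "0 \<le> u" "u \<le> 1" and "w = (1-u) *\<^sub>R a + u *\<^sub>R b \<or> w = (1-u) *\<^sub>R a + u *\<^sub>R (-b)"
      using \<open>w \<in> _ \<or> _\<close> by (auto simp: closed_segment_def)
    then have "Re w = -(e/2) * (1-u)" "\<bar>Im w\<bar> = u * R"
      using R by (auto simp: a_def b_def abs_mult)
    moreover have "u * R \<le> 1 * R" "(e/2) * (1-u) \<le> (e/2) * 1"
      using u R e by (intro mult_right_mono mult_left_mono; simp)+
    ultimately show ?thesis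
      using R e u by (auto simp: S_def mult_less_0_iff abs_le_iff; linarith)
  qed
  have \<eta>: "valid_path \<eta>" "pathstart \<eta> = \<i> * of_real R" "pathfinish \<eta> = -(\<i> * of_real R)"
    by (auto simp: \<eta>_def b_def)
  have im\<eta>: "path_image \<eta> = closed_segment a b \<union> closed_segment a (-b)"
    by (simp add: \<eta>_def path_image_join closed_segment_commute)
  have \<gamma>: "valid_path \<gamma>" "pathstart \<gamma> = \<i> * of_real R" "pathfinish \<gamma> = -(\<i> * of_real R)"
  proof -
    have "cis (3*pi/2) = -\<i>"
      using cos_3over2_pi sin_3over2_pi by (simp add: complex_eq_iff mult.commute)
    then show "pathstart \<gamma> = \<i> * of_real R" "pathfinish \<gamma> = -(\<i> * of_real R)"
      unfolding \<gamma>_def pathstart_part_circlepath pathfinish_part_circlepath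
      by (simp_all flip: cis_conv_exp del: of_real_divide of_real_mult)
  qed (simp add: \<gamma>_def)
  have im\<gamma>: "norm w = R \<and> Re w \<le> 0" if w: "w \<in> path_image \<gamma>" for w
  proof -
    obtain x where x: "pi/2 \<le> x" "x \<le> 3*pi/2" "w = of_real R * exp (\<i> * of_real x)"
      using w pi_ge_zero unfolding \<gamma>_def
      by (subst (asm) path_image_part_circlepath) auto
    have "0 \<le> cos (x - pi)"
      using x by (intro cos_ge_zero) auto
    then show ?thesis
      using R x by (auto simp: norm_mult Re_exp mult_nonneg_nonpos)
  qed
  have arcS: "path_image (right_arc R) \<subseteq> S"
  proof
    fix w assume "w \<in> path_image (right_arc R)"
    then show "w \<in> S"
      using right_arc_image[OF R, of w] abs_Im_le_cmod[of w] e by (auto simp: S_def)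
  qed
  \<comment> \<open>The value 1 at 0 makes Cauchy's formula return \<open>G 0\<close> and
    \<open>g T 0\<close> themselves.\<close>
  define k where "k = (\<lambda>T z::complex. exp (of_real T * z) * (1 + z\<^sup>2 / of_real (R\<^sup>2)))"
  have k: "k T holomorphic_on A" "k T 0 = 1" for T A
    by (auto simp: k_def intro!: holomorphic_intros)
  define h where "h = (\<lambda>z. G z * (1 + z\<^sup>2 / of_real (R\<^sup>2)) / z)"
  have h: "continuous_on (closed_segment a b) h" "continuous_on (closed_segment a (-b)) h"
  proof -
    have "h holomorphic_on S - {0}"
      unfolding h_def using G \<open>S \<subseteq> U\<close>
      by (auto intro!: holomorphic_intros elim: holomorphic_on_subset)
    then have "continuous_on (S - {0}) h"
      by (rule holomorphic_on_imp_continuous_on)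
    then show "continuous_on (closed_segment a b) h" "continuous_on (closed_segment a (-b)) h"
      by (rule continuous_on_subset; use neg in blast)+
  qed
  define E where "E = (\<lambda>T. contour_integral \<eta> (\<lambda>w. G w * k T w / w))"
  have main: "2 * pi * norm (G 0 - g T 0) \<le> norm (E T) + 4 * B / R * pi" if T: "T \<ge> 0" for T
  proof -
    have GS: "(\<lambda>w. G w * k T w) holomorphic_on S"
      using G \<open>S \<subseteq> U\<close> k by (intro holomorphic_intros) (auto elim: holomorphic_on_subset)
    have gU: "(\<lambda>w. g T w * k T w) holomorphic_on UNIV"
      using g[OF T] k by (intro holomorphic_intros)
    have ne: "0 \<notin> path_image \<eta>" "0 \<notin> path_image \<gamma>"
      using neg im\<gamma>[of 0] R by (auto simp: im\<eta>)
    have left\<eta>: "\<And>w. w \<in> path_image \<eta> \<Longrightarrow> Re w \<le> 0" "\<And>w. w \<in> path_image \<gamma> \<Longrightarrow> Re w \<le> 0"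
      and \<eta>S: "path_image \<eta> \<subseteq> S"
      using neg im\<gamma> by (auto simp: im\<eta>)
    note F1 = half_circle_formula[OF R \<eta> left\<eta>(1) ne(1) S arcS \<eta>S GS]
    note F2 = half_circle_formula[OF R \<gamma> left\<eta>(2) ne(2) convex_UNIV open_UNIV UNIV_I subset_UNIV subset_UNIV gU]
    let ?A = "contour_integral (right_arc R) (\<lambda>w. G w * k T w / w - g T w * k T w / w)"
    let ?L = "contour_integral \<gamma> (\<lambda>w. g T w * k T w / w)"
    \<comment> \<open>Subtracting the two Cauchy formulas merges the integrals over the common right
      arc, where only the difference \<open>G - g T\<close> is controlled.\<close>
    have eq: "2 * pi * \<i> * (G 0 - g T 0) = ?A + E T - ?L"
    proof -
      have "2 * pi * \<i> * G 0 = contour_integral (right_arc R) (\<lambda>w. G w * k T w / w) + E T"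
           "2 * pi * \<i> * g T 0 = contour_integral (right_arc R) (\<lambda>w. g T w * k T w / w) + ?L"
        using F1(3) F2(3) k(2) by (simp_all add: E_def)
      then show ?thesis
        unfolding right_diff_distrib using contour_integral_diff[OF F1(1) F2(1)] by simp
    qed
    have kernel: "B * exp (-(T * Re w)) / \<bar>Re w\<bar> * (2 * \<bar>Re w\<bar> * exp (T * Re w) / R\<^sup>2) = 2 * B / R\<^sup>2"
      if "Re w \<noteq> 0" for w
      using that by (simp add: exp_minus field_simps)
    \<comment> \<open>The hypotheses \<open>right\<close> and \<open>left\<close> say nothing on the
      imaginary axis. The arcs meet it only in these two points, which become the finite exceptional
      set of the integral bounds below.\<close>
    have onaxis: "w \<in> {\<i> * of_real R, -(\<i> * of_real R)}" if "norm w = R" "Re w = 0" for w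
    proof -
      have "\<bar>Im w\<bar> = R" using that by (simp add: cmod_def)
      then show ?thesis using that(2) by (auto simp: complex_eq_iff abs_if split: if_splits)
    qed
    have "norm ?A \<le> 2 * B / R\<^sup>2 * R * (pi/2 - (-(pi/2)))"
      unfolding right_arc_def
    proof (rule contour_integral_bound_part_circlepath_strong
        [where k = "{\<i> * of_real R, -(\<i> * of_real R)}"])
      show "(\<lambda>w. G w * k T w / w - g T w * k T w / w) contour_integrable_on part_circlepath 0 R (-(pi/2)) (pi/2)"
        using contour_integrable_diff[OF F1(1) F2(1)] by (simp add: right_arc_def)
    next
      fix w assume "w \<in> path_image (part_circlepath 0 R (-(pi/2)) (pi/2)) - {\<i> * of_real R, -(\<i> * of_real R)}"
      then have w: "norm w = R" "Re w > 0"
        using right_arc_image[OF R, of w] onaxis[of w] by (force simp: right_arc_def)+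
      have "norm (G w * k T w / w - g T w * k T w / w) = norm (G w - g T w) * norm (k T w / w)"
        by (simp add: diff_divide_distrib left_diff_distrib flip: norm_mult)
      also have "\<dots> \<le> B * exp (-(T * Re w)) / \<bar>Re w\<bar> * (2 * \<bar>Re w\<bar> * exp (T * Re w) / R\<^sup>2)"
      proof (rule mult_mono)
        show "norm (G w - g T w) \<le> B * exp (-(T * Re w)) / \<bar>Re w\<bar>"
          using right[OF T w(2)] w(2) by simp
        show "norm (k T w / w) \<le> 2 * \<bar>Re w\<bar> * exp (T * Re w) / R\<^sup>2"
          using newman_kernel_norm[OF w(1) R, of T] by (simp add: k_def)
      qed (use B in simp_all)
      also have "\<dots> = 2 * B / R\<^sup>2"
        using w(2) by (intro kernel) auto
      finally show "norm (G w * k T w / w - g T w * k T w / w) \<le> 2 * B / R\<^sup>2" .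
    qed (use B R in auto)
    moreover have "norm ?L \<le> 2 * B / R\<^sup>2 * R * (3*pi/2 - pi/2)"
      unfolding \<gamma>_def
    proof (rule contour_integral_bound_part_circlepath_strong
        [where k = "{\<i> * of_real R, -(\<i> * of_real R)}"])
      show "(\<lambda>w. g T w * k T w / w) contour_integrable_on part_circlepath 0 R (pi/2) (3*pi/2)"
        using F2(2) by (simp add: \<gamma>_def)
    next
      fix w assume "w \<in> path_image (part_circlepath 0 R (pi/2) (3*pi/2)) - {\<i> * of_real R, -(\<i> * of_real R)}"
      then have w: "norm w = R" "Re w < 0"
        using im\<gamma>[of w] onaxis[of w] by (force simp: \<gamma>_def)+
      have "norm (g T w * k T w / w) = norm (g T w) * norm (k T w / w)"
        by (simp flip: norm_mult)
      also have "\<dots> \<le> B * exp (-(T * Re w)) / \<bar>Re w\<bar> * (2 * \<bar>Re w\<bar> * exp (T * Re w) / R\<^sup>2)"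
      proof (rule mult_mono)
        show "norm (g T w) \<le> B * exp (-(T * Re w)) / \<bar>Re w\<bar>"
          using left[OF T w(2)] w(2) by simp
        show "norm (k T w / w) \<le> 2 * \<bar>Re w\<bar> * exp (T * Re w) / R\<^sup>2"
          using newman_kernel_norm[OF w(1) R, of T] by (simp add: k_def)
      qed (use B in simp_all)
      also have "\<dots> = 2 * B / R\<^sup>2"
        using w(2) by (intro kernel) auto
      finally show "norm (g T w * k T w / w) \<le> 2 * B / R\<^sup>2" .
    qed (use B R in auto)
    moreover have "norm (2 * pi * \<i> * (G 0 - g T 0)) \<le> norm ?A + norm (E T) + norm ?L"
      unfolding eq by norm
    moreover have "2 * B / R\<^sup>2 * R * (pi/2 - (-(pi/2))) = 2 * (B / R * pi)"
                  "2 * B / R\<^sup>2 * R * (3*pi/2 - pi/2) = 2 * (B / R * pi)"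
      using R by (simp_all add: field_simps power2_eq_square)
    moreover have "norm (2 * pi * \<i> * (G 0 - g T 0)) = 2 * pi * norm (G 0 - g T 0)"
      by (simp add: norm_mult)
    ultimately show ?thesis
      by simp
  qed
  have "(E \<longlongrightarrow> 0) at_top"
  proof -
    have Eeq: "E T = contour_integral (linepath a (-b)) (\<lambda>z. h z * exp (of_real T * z))
                  - contour_integral (linepath a b) (\<lambda>z. h z * exp (of_real T * z))" for T
    proof -
      have fun_eq: "(\<lambda>w. G w * k T w / w) = (\<lambda>z. h z * exp (of_real T * z))"
        by (auto simp: h_def k_def)
      have *: "(\<lambda>z. h z * exp (of_real T * z)) contour_integrable_on linepath a b"
              "(\<lambda>z. h z * exp (of_real T * z)) contour_integrable_on linepath b a"
              "(\<lambda>z. h z * exp (of_real T * z)) contour_integrable_on linepath a (-b)"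
        using h by (auto intro!: contour_integrable_continuous_linepath continuous_intros
                         simp: closed_segment_commute)
      then show ?thesis
        unfolding E_def fun_eq \<eta>_def
        using contour_integral_reversepath[of "linepath a b"] by simp
    qed
    have "((\<lambda>T. contour_integral (linepath a (-b)) (\<lambda>z. h z * exp (of_real T * z))
                  - contour_integral (linepath a b) (\<lambda>z. h z * exp (of_real T * z))) \<longlongrightarrow> 0 - 0) at_top"
      using h e by (intro tendsto_diff contour_integral_decay) (auto simp: a_def b_def)
    then show ?thesis
      by (simp add: Eeq[abs_def])
  qed
  then have "\<forall>\<^sub>F T in at_top. norm (E T) < \<epsilon> * pi"
    using tendstoD[of E 0 at_top "\<epsilon> * pi"] \<epsilon> by (simp add: dist_norm)
  then show "\<forall>\<^sub>F T in at_top. dist (g T 0) (G 0) < \<epsilon>"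
    using eventually_ge_at_top[of 0]
  proof eventually_elim
    case (elim T)
    have "4 * B / R * pi < \<epsilon> * pi"
      using \<open>4 * B / R < \<epsilon>\<close> by (rule mult_strict_right_mono) simp
    with main[OF elim(2)] elim(1) have "2 * pi * norm (G 0 - g T 0) < \<epsilon> * pi + \<epsilon> * pi"
      by linarith
    also have "\<dots> = 2 * pi * \<epsilon>"
      by simp
    finally have "2 * pi * norm (G 0 - g T 0) < 2 * pi * \<epsilon>" .
    then show ?case
      by (simp add: dist_norm norm_minus_commute)
  qed
qed

section \<open>Chebyshev's functions\<close>

definition chebyshev_psi :: "real \<Rightarrow> real" where
  "chebyshev_psi x = (\<Sum>n | real n \<le> x. mangoldt n)"

section \<open>Chebyshev's upper bound for \<open>chebyshev_psi\<close>\<close>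

lemma finite_nat_le_real [simp]: "finite {n. real n \<le> x}"
  by (rule finite_subset[of _ "{..nat \<lfloor>x\<rfloor>}"]) (auto simp: le_nat_floor)

lemma chebyshev_psi_of_nat: "chebyshev_psi (real N) = (\<Sum>n=1..N. mangoldt n)"
  unfolding chebyshev_psi_def by (rule sum.mono_neutral_right) (auto simp: not_le)

lemma chebyshev_psi_nonneg: "chebyshev_psi x \<ge> 0"
  unfolding chebyshev_psi_def by (intro sum_nonneg mangoldt_nonneg)

lemma chebyshev_psi_mono: "x \<le> y \<Longrightarrow> chebyshev_psi x \<le> chebyshev_psi y"
  unfolding chebyshev_psi_def by (intro sum_mono2) (auto simp: mangoldt_nonneg)

text \<open>Passing from \<open>N\<close> to \<open>N + 1\<close> raises \<open>N div d\<close> by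
  one exactly when \<open>d\<close> divides \<open>N + 1\<close>, and the von Mangoldt function
  summed over the divisors of \<open>N + 1\<close> is \<open>ln (N + 1)\<close>.\<close>

lemma ln_fact_eq_sum_mangoldt:
  "ln (fact N) = (\<Sum>d=1..N. mangoldt d * real (N div d))"
proof (induction N)
  case (Suc N)
  have "(\<Sum>d=1..Suc N. mangoldt d * real (Suc N div d))
      = (\<Sum>d=1..Suc N. mangoldt d * real (N div d) + (if d dvd Suc N then mangoldt d else 0))"
    by (intro sum.cong) (auto simp: div_Suc dvd_eq_mod_eq_0 algebra_simps)
  also have "\<dots> = (\<Sum>d=1..N. mangoldt d * real (N div d)) + (\<Sum>d | d dvd Suc N. mangoldt d)"
  proof -
    have "{d. d dvd Suc N} = {d \<in> {1..Suc N}. d dvd Suc N}"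
      by (auto simp: Suc_le_eq dest: dvd_imp_le intro: dvd_pos_nat[of "Suc N"])
    then have "(\<Sum>d | d dvd Suc N. mangoldt d) = (\<Sum>d=1..Suc N. if d dvd Suc N then mangoldt d else (0::real))"
      by (simp only: sum.inter_filter[OF finite_atLeastAtMost])
    then show ?thesis
      by (simp add: sum.distrib)
  qed
  also have "\<dots> = ln (fact N) + ln (real (Suc N))"
    using Suc mangoldt_sum[of "Suc N", where ?'a = real] by simp
  also have "\<dots> = ln (fact (Suc N))"
    by (simp add: ln_mult)
  finally show ?case ..
qed simp

text \<open>The logarithm of the central binomial coefficient is the sum of
  \<open>mangoldt d * (2 * n div d - 2 * (n div d))\<close>. Every bracket is nonnegative and is at
  least 1 for \<open>n < d \<le> 2 * n\<close>, so the sum dominates the left-hand side, while the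
  coefficient is at most \<open>2 ^ (2 * n)\<close>.\<close>

lemma chebyshev_psi_double_diff:
  "chebyshev_psi (real (2 * n)) - chebyshev_psi (real n) \<le> 2 * ln 2 * real n"
proof -
  have "chebyshev_psi (real (2 * n)) - chebyshev_psi (real n) = (\<Sum>d\<in>{1..2*n} - {1..n}. mangoldt d)"
    unfolding chebyshev_psi_of_nat by (rule sum_diff[symmetric]) auto
  also have "\<dots> = (\<Sum>d=1..2*n. if d \<in> {1..2*n} - {1..n} then mangoldt d else 0)"
    by (rule sum.mono_neutral_cong_left) auto
  also have "\<dots> \<le> (\<Sum>d=1..2*n. mangoldt d * (real (2 * n div d) - 2 * real (n div d)))"
  proof (rule sum_mono)
    fix d assume d: "d \<in> {1..2*n}"
    have "2 * (n div d) \<le> 2 * n div d"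
      using d by (simp add: less_eq_div_iff_mult_less_eq mult.assoc)
    then have "real (2 * (n div d)) \<le> real (2 * n div d)"
      by (rule of_nat_mono)
    then have *: "2 * real (n div d) \<le> real (2 * n div d)"
      by simp
    show "(if d \<in> {1..2*n} - {1..n} then mangoldt d else 0)
          \<le> mangoldt d * (real (2 * n div d) - 2 * real (n div d))"
    proof (cases "n < d")
      case True
      then have "1 \<le> real (2 * n div d) - 2 * real (n div d)"
        using d by (simp add: Suc_le_eq div_greater_zero_iff)
      from mult_left_mono[OF this mangoldt_nonneg[of d]] show ?thesis
        using True d by simp
    next
      case False
      then show ?thesis
        using d * mangoldt_nonneg[of d] by simp
    qed
  qed
  also have "\<dots> = ln (fact (2 * n)) - 2 * (\<Sum>d=1..2*n. mangoldt d * real (n div d))"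
    by (simp add: ln_fact_eq_sum_mangoldt algebra_simps sum_subtractf sum_distrib_left)
  also have "(\<Sum>d=1..2*n. mangoldt d * real (n div d)) = ln (fact n)"
    unfolding ln_fact_eq_sum_mangoldt by (rule sum.mono_neutral_right) auto
  also have "ln (fact (2 * n)) - 2 * ln (fact n) = ln (real (2 * n choose n))"
    by (simp add: binomial_fact ln_div ln_mult)
  also have "\<dots> \<le> ln (2 ^ (2 * n))"
  proof -
    have "real (2 * n choose n) \<le> real (2 ^ (2 * n))"
      by (intro of_nat_mono binomial_le_pow2)
    moreover have "0 < real (2 * n choose n)"
      by simp
    ultimately show ?thesis
      by (intro ln_mono) simp_all
  qed
  also have "\<dots> = 2 * ln 2 * real n"
    by (subst ln_realpow) auto
  finally show ?thesis .
qed

text \<open>Doubling steps add up geometrically to \<open>2 * ln 2 * 2 ^ k\<close> at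
  \<open>2 ^ k\<close>. Rounding \<open>x\<close> up to the next power of two costs a factor of at
  most 2, and \<open>ln 2 < 1\<close> gives the constant 4.\<close>

lemma chebyshev_psi_le:
  assumes "x \<ge> 0"
  shows "chebyshev_psi x \<le> 4 * x"
proof (cases "x \<ge> 1")
  case False
  then have "{n. real n \<le> x} = {0}"
    using assms by auto
  then show ?thesis
    using assms by (simp add: chebyshev_psi_def)
next
  case True
  have pow: "chebyshev_psi (real (2 ^ k)) \<le> 2 * ln 2 * 2 ^ k" for k
  proof (induction k)
    case 0
    show ?case using chebyshev_psi_of_nat[of 1] by simp
  next
    case (Suc k)
    then show ?case
      using chebyshev_psi_double_diff[of "2 ^ k"] by simp
  qed
  define k where "k = nat \<lfloor>log 2 x\<rfloor>"
  have "log 2 x \<ge> 0"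
    using True by simp
  then have "real k \<le> log 2 x" "log 2 x < real (Suc k)"
    unfolding k_def by linarith+
  then have k: "2 ^ k \<le> x" "x \<le> 2 ^ Suc k"
    using True by (auto simp: le_log_iff log_less_iff powr_realpow powr_add)
  have "chebyshev_psi x \<le> chebyshev_psi (real (2 ^ Suc k))"
    using k by (intro chebyshev_psi_mono) auto
  also have "\<dots> \<le> 2 * ln 2 * 2 ^ Suc k"
    by (rule pow)
  also have "\<dots> \<le> 4 * 1 * 2 ^ k"
    using ln_2_less_1 by simp
  also have "\<dots> \<le> 4 * x"
    using k by simp
  finally show ?thesis .
qed

text \<open>
  The assumed function is the integral of \<open>(\<psi>(u) - u) / u\<^sup>2\<close> over \<open>[1, x]\<close>, up to a constant, in a form that
  avoids the integral. Its increments from \<open>x\<close> to \<open>l x\<close> tend to 0, and monotonicity of \<open>\<psi>\<close> bounds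
  them in terms of \<open>\<psi>(x) / x\<close>.
\<close>

lemma chebyshev_psi_asymptotics:
  assumes J: "((\<lambda>x. (\<Sum>n | real n \<le> x. mangoldt n / real n) - chebyshev_psi x / x - ln x) \<longlongrightarrow> L) at_top"
  shows "((\<lambda>x. chebyshev_psi x / x) \<longlongrightarrow> 1) at_top"
proof (rule tendstoI)
  fix \<epsilon> :: real assume \<epsilon>: "\<epsilon> > 0"
  define l where "l = 1 + \<epsilon> / 2"
  have l: "l > 1" using \<epsilon> by (simp add: l_def)
  define J where "J = (\<lambda>x. (\<Sum>n | real n \<le> x. mangoldt n / real n) - chebyshev_psi x / x - ln x)"
  \<comment> \<open>For \<open>x < n \<le> l * x\<close> the weight \<open>1 / n\<close> lies
    between \<open>1 / (l * x)\<close> and \<open>1 / x\<close>. With either extreme the sum becomes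
    a multiple of the increment of \<open>chebyshev_psi\<close>, and one of its two values cancels
    against the boundary terms.\<close>
  have diff: "chebyshev_psi x / x * (1 - 1 / l) - ln l \<le> J (l * x) - J x"
             "J (l * x) - J x \<le> chebyshev_psi (l * x) / (l * x) * (l - 1) - ln l" if x: "x > 0" for x
  proof -
    have frac: "u / x * (1 - 1 / l) = u / x - u / (l * x)" "u / (l * x) * (l - 1) = u / x - u / (l * x)" for u
      using x l by (simp_all add: field_simps)
    have sub: "{n. real n \<le> x} \<subseteq> {n. real n \<le> l * x}"
      using x l by (auto intro: order.trans[of _ x])
    have A: "chebyshev_psi (l * x) - chebyshev_psi x = (\<Sum>n\<in>{n. real n \<le> l * x} - {n. real n \<le> x}. mangoldt n)"
      unfolding chebyshev_psi_def using sub by (subst sum_diff) auto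
    have B: "J (l * x) - J x = (\<Sum>n\<in>{n. real n \<le> l * x} - {n. real n \<le> x}. mangoldt n / real n)
               - chebyshev_psi (l * x) / (l * x) + chebyshev_psi x / x - ln l"
      unfolding J_def using sub x l by (subst sum_diff) (auto simp: ln_mult)
    have "(chebyshev_psi (l * x) - chebyshev_psi x) / (l * x)
       \<le> (\<Sum>n\<in>{n. real n \<le> l * x} - {n. real n \<le> x}. mangoldt n / real n)"
      unfolding A sum_divide_distrib using x by (intro sum_mono divide_left_mono mangoldt_nonneg) auto
    moreover have "(\<Sum>n\<in>{n. real n \<le> l * x} - {n. real n \<le> x}. mangoldt n / real n)
         \<le> (chebyshev_psi (l * x) - chebyshev_psi x) / x"
      unfolding A sum_divide_distrib using x by (intro sum_mono divide_left_mono mangoldt_nonneg) auto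
    ultimately show "chebyshev_psi x / x * (1 - 1 / l) - ln l \<le> J (l * x) - J x"
             "J (l * x) - J x \<le> chebyshev_psi (l * x) / (l * x) * (l - 1) - ln l"
      unfolding B diff_divide_distrib frac by linarith+
  qed
  have lim: "((\<lambda>x. J (l * x) - J x) \<longlongrightarrow> L - L) at_top"
    unfolding J_def using l
    by (intro tendsto_diff[OF filterlim_compose[OF J] J] 
        filterlim_tendsto_pos_mult_at_top[OF tendsto_const] filterlim_ident) auto
  have l': "(l - 1) / l = 1 - 1 / l"
    using l by (simp add: field_simps)
  \<comment> \<open>After division by \<open>(l - 1) / l\<close> this costs
    \<open>\<epsilon> / 2\<close>; the other \<open>\<epsilon> / 2\<close> is \<open>l - 1\<close>,
    lost by estimating \<open>ln l\<close>.\<close>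
  define \<delta> where "\<delta> = \<epsilon> / 2 * ((l - 1) / l)"
  have "\<delta> > 0" using l \<epsilon> by (simp add: \<delta>_def)
  have ev: "\<forall>\<^sub>F x in at_top. \<bar>J (l * x) - J x\<bar> < \<delta> \<and> x > 0"
    using tendstoD[OF lim \<open>\<delta> > 0\<close>] eventually_gt_at_top[of 0] by eventually_elim (simp add: dist_norm)
  have upper: "\<forall>\<^sub>F x in at_top. chebyshev_psi x / x < 1 + \<epsilon>"
    using ev
  proof eventually_elim
    case (elim x)
    have "chebyshev_psi x / x * ((l - 1) / l) < \<delta> + ln l"
      using diff(1)[of x] elim unfolding l' by linarith
    also have "\<dots> \<le> (\<epsilon> / 2 + l) * ((l - 1) / l)"
    proof -
      have "l * ((l - 1) / l) = l - 1" using l by simp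
      then show ?thesis
        unfolding \<delta>_def distrib_right using ln_le_minus_one[of l] l by linarith
    qed
    finally have "chebyshev_psi x / x < \<epsilon> / 2 + l"
      using l by (subst (asm) mult_less_cancel_right_pos) auto
    then show ?case
      by (simp add: l_def)
  qed
  \<comment> \<open>Here \<open>ln l\<close> is bounded below by \<open>1 - 1 / l\<close>, which
    leaves \<open>(1 - \<epsilon> / 2) / l\<close>; this is at least \<open>1 - \<epsilon>\<close>
    because \<open>(1 - \<epsilon>) * (1 + \<epsilon> / 2) \<le> 1 - \<epsilon> / 2\<close>.\<close>
  have lower: "\<forall>\<^sub>F x in at_top. chebyshev_psi (l * x) / (l * x) > 1 - \<epsilon>"
    using ev
  proof eventually_elim
    case (elim x)
    have "1 - 1 / l \<le> ln l"
      using ln_le_minus_one[of "1 / l"] l by (simp add: ln_div)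
    then have "(1 - 1 / l) - \<delta> < chebyshev_psi (l * x) / (l * x) * (l - 1)"
      using diff(2)[of x] elim by linarith
    moreover have "(1 - 1 / l) - \<delta> = (1 - \<epsilon> / 2) / l * (l - 1)"
      using l by (simp add: \<delta>_def field_simps)
    ultimately have "(1 - \<epsilon> / 2) / l * (l - 1) < chebyshev_psi (l * x) / (l * x) * (l - 1)"
      by linarith
    then have "(1 - \<epsilon> / 2) / l < chebyshev_psi (l * x) / (l * x)"
      using l by (subst (asm) mult_less_cancel_right_pos) auto
    moreover have "(1 - \<epsilon>) * l \<le> 1 - \<epsilon> / 2"
      by (simp add: l_def algebra_simps)
    then have "1 - \<epsilon> \<le> (1 - \<epsilon> / 2) / l"
      using l by (simp add: pos_le_divide_eq)
    ultimately show ?case by linarith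
  qed
  \<comment> \<open>The lower bound was obtained at \<open>l * x\<close>; the substitution of
    \<open>x / l\<close> for \<open>x\<close> moves it to \<open>x\<close>.\<close>
  have "filterlim (\<lambda>x. 1 / l * x) at_top at_top"
    using l by (intro filterlim_tendsto_pos_mult_at_top[OF tendsto_const] filterlim_ident) auto
  from eventually_compose_filterlim[OF lower this]
  have "\<forall>\<^sub>F x in at_top. chebyshev_psi x / x > 1 - \<epsilon>"
    using l by simp
  with upper show "\<forall>\<^sub>F x in at_top. dist (chebyshev_psi x / x) 1 < \<epsilon>"
    by eventually_elim (auto simp: dist_real_def)
qed

section \<open>The contribution of the proper prime powers\<close>

lemma chebyshev_psi_minus_theta:
  assumes x: "x \<ge> 1"
  shows "0 \<le> chebyshev_psi x - chebyshev_theta x"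
    and "chebyshev_psi x - chebyshev_theta x \<le> sqrt x * (log 2 x + 1) * ln x"
proof -
  define A where "A = {n. real n \<le> x \<and> primepow n \<and> \<not> prime n}"
  have "chebyshev_psi x = (\<Sum>n\<in>{n. prime n \<and> real n \<le> x} \<union> A. mangoldt n)"
    unfolding chebyshev_psi_def 
    by (rule sum.mono_neutral_right) (auto simp: A_def mangoldt_def)
  also have "\<dots> = (\<Sum>n | prime n \<and> real n \<le> x. mangoldt n) + (\<Sum>n\<in>A. mangoldt n)"
    by (rule sum.union_disjoint) (auto simp: A_def)
  finally have eq: "chebyshev_psi x - chebyshev_theta x = (\<Sum>n\<in>A. mangoldt n)"
    by (simp add: chebyshev_theta_def)
  show "0 \<le> chebyshev_psi x - chebyshev_theta x"
    unfolding eq by (intro sum_nonneg mangoldt_nonneg)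
  \<comment> \<open>A proper power \<open>p ^ k \<le> x\<close> has \<open>k \<ge> 2\<close>, hence
    \<open>p \<le> sqrt x\<close>, and \<open>p \<ge> 2\<close> forces
    \<open>k \<le> log 2 x\<close>. Counting exponents from 0 accounts for the \<open>+ 1\<close> in
    the bound.\<close>
  define P where "P = {1..nat \<lfloor>sqrt x\<rfloor>} \<times> {..nat \<lfloor>log 2 x\<rfloor>}"
  have "A \<subseteq> (\<lambda>(p, k). p ^ k) ` P"
  proof
    fix n assume n: "n \<in> A"
    then obtain p k where pk: "prime p" "k > 0" "n = p ^ k"
      by (auto simp: A_def primepow_def)
    have "k \<noteq> 1"
      using n pk by (auto simp: A_def)
    with pk have k: "k \<ge> 2" by simp
    have p: "p \<ge> 2" using pk prime_ge_2_nat by blast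
    have nx: "real p ^ k \<le> x"
      using n pk by (simp add: A_def)
    have "real p ^ 2 \<le> real p ^ k"
      using p k by (intro power_increasing) auto
    then have "real p \<le> sqrt x"
      using nx by (intro real_le_rsqrt) simp
    moreover have "2 ^ k \<le> real p ^ k"
      using p by (intro power_mono) auto
    then have "real k \<le> log 2 x"
      using nx x by (simp add: le_log_iff powr_realpow)
    ultimately have "(p, k) \<in> P"
      using p by (auto simp: P_def le_nat_floor)
    then show "n \<in> (\<lambda>(p, k). p ^ k) ` P"
      using pk by force
  qed
  then have "card A \<le> card P"
    by (intro surj_card_le) (auto simp: P_def)
  also have "card P = nat \<lfloor>sqrt x\<rfloor> * (nat \<lfloor>log 2 x\<rfloor> + 1)"
    by (simp add: P_def)
  finally have "real (card A) \<le> real (nat \<lfloor>sqrt x\<rfloor> * (nat \<lfloor>log 2 x\<rfloor> + 1))"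
    by (rule of_nat_mono)
  also have "\<dots> = real (nat \<lfloor>sqrt x\<rfloor>) * (real (nat \<lfloor>log 2 x\<rfloor>) + 1)"
    by (simp only: of_nat_mult of_nat_add of_nat_1)
  also have "\<dots> \<le> sqrt x * (log 2 x + 1)"
    using x by (intro mult_mono add_mono) auto
  finally have card: "real (card A) \<le> sqrt x * (log 2 x + 1)" .
  have "(\<Sum>n\<in>A. mangoldt n) \<le> real (card A) * ln x"
  proof (rule sum_bounded_above)
    fix n assume n: "n \<in> A"
    then have "n > 0" by (auto simp: A_def intro!: Nat.gr0I)
    then have "mangoldt n \<le> ln (real n)" by (rule mangoldt_le)
    also have "\<dots> \<le> ln x"
      using n \<open>n > 0\<close> by (intro ln_mono) (auto simp: A_def)
    finally show "mangoldt n \<le> ln x" .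
  qed
  also have "\<dots> \<le> sqrt x * (log 2 x + 1) * ln x"
    using card x by (intro mult_right_mono) auto
  finally show "chebyshev_psi x - chebyshev_theta x \<le> sqrt x * (log 2 x + 1) * ln x"
    unfolding eq .
qed

lemma chebyshev_theta_asymptotics:
  assumes "((\<lambda>x. chebyshev_psi x / x) \<longlongrightarrow> 1) at_top"
  shows "((\<lambda>x. chebyshev_theta x / x) \<longlongrightarrow> 1) at_top"
proof -
  have "((\<lambda>x. (chebyshev_psi x - chebyshev_theta x) / x) \<longlongrightarrow> 0) at_top"
  proof (rule tendsto_sandwich[OF _ _ tendsto_const])
    show "\<forall>\<^sub>F x in at_top. 0 \<le> (chebyshev_psi x - chebyshev_theta x) / x"
      using eventually_ge_at_top[of 1] by eventually_elim (use chebyshev_psi_minus_theta(1) in force)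
    show "\<forall>\<^sub>F x in at_top. (chebyshev_psi x - chebyshev_theta x) / x \<le> sqrt x * (log 2 x + 1) * ln x / x"
      using eventually_ge_at_top[of 1]
      by eventually_elim (intro divide_right_mono chebyshev_psi_minus_theta(2), auto)
    show "((\<lambda>x::real. sqrt x * (log 2 x + 1) * ln x / x) \<longlongrightarrow> 0) at_top"
      by real_asymp
  qed
  from tendsto_diff[OF assms this] show ?thesis
    by (simp add: diff_divide_distrib)
qed

section \<open>The zeta function near the line \<open>Re s = 1\<close>\<close>

text \<open>The series may start at \<open>n = 0\<close> because \<open>0 powr w = 0\<close>: that
  term vanishes whatever \<open>a 0\<close> is.\<close>

definition dirichlet :: "(nat \<Rightarrow> real) \<Rightarrow> complex \<Rightarrow> complex" where
  "dirichlet a s = (\<Sum>n. of_real (a n) * of_nat n powr (- s))"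

lemma norm_of_nat_powr: "norm (of_nat n powr s :: complex) = real n powr Re s"
  by (simp add: norm_powr_real_powr)

text \<open>Real exponents suffice, since the modulus of a term of the series depends on
  \<open>s\<close> only through \<open>Re s\<close>.\<close>

definition converges_gt_1 :: "(nat \<Rightarrow> real) \<Rightarrow> bool" where
  "converges_gt_1 a \<longleftrightarrow> (\<forall>\<sigma>>1. summable (\<lambda>n. \<bar>a n\<bar> * real n powr (- \<sigma>)))"

lemma dirichlet_summable:
  assumes "converges_gt_1 a" "Re s > 1"
  shows "summable (\<lambda>n. norm (of_real (a n) * of_nat n powr (- s) :: complex))"
  using assms by (simp add: norm_mult norm_of_nat_powr converges_gt_1_def)

lemma dirichlet_sums:
  assumes "converges_gt_1 a" "Re s > 1"
  shows "(\<lambda>n. of_real (a n) * of_nat n powr (- s)) sums dirichlet a s"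
  unfolding dirichlet_def
  by (rule summable_sums[OF summable_norm_cancel[OF dirichlet_summable[OF assms]]])

lemma dirichlet_deriv:
  assumes "converges_gt_1 a" "Re s > 1"
  shows "(dirichlet a has_field_derivative - dirichlet (\<lambda>n. ln (real n) * a n) s) (at s)"
proof -
  let ?S = "{s. Re s > 1}"
  have S: "open ?S"
    by (simp add: open_halfspace_Re_gt)
  have "\<exists>g g'. \<forall>s \<in> ?S. ((\<lambda>n. of_real (a n) * of_nat n powr (- s)) sums g s) \<and>
          ((\<lambda>n. - (of_real (ln (real n) * a n) * of_nat n powr (- s))) sums g' s) \<and> 
          (g has_field_derivative g' s) (at s)"
  proof (rule series_and_derivative_comparison_complex[OF S])
    fix n :: nat and s :: complex
    show "((\<lambda>s. of_real (a n) * of_nat n powr (- s)) has_field_derivative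
            - (of_real (ln (real n) * a n) * of_nat n powr (- s))) (at s)"
    proof (cases "n = 0")
      case False
      have "((\<lambda>s. of_nat n powr (- s)) has_field_derivative Ln (of_nat n) * of_nat n powr (- s) * - 1) (at s)"
        by (rule DERIV_chain2[OF has_field_derivative_powr_right])
           (use False in \<open>auto intro!: derivative_eq_intros\<close>)
      from DERIV_cmult[OF this, of "of_real (a n)"] False show ?thesis
        by (simp add: Ln_of_nat mult_ac)
    qed simp
  next
    fix s :: complex assume s: "s \<in> ?S"
    \<comment> \<open>Half the distance to the line \<open>Re s = 1\<close>: on the ball of this
      radius all terms are dominated by those at the real point \<open>Re s - d\<close>, which still
      exceeds 1.\<close>
    define d where "d = (Re s - 1) / 2"
    have d: "d > 0" "Re s - d > 1" using s by (simp_all add: d_def field_simps)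
    define h where "h = (\<lambda>n. complex_of_real (\<bar>a n\<bar> * real n powr (- (Re s - d))))"
    have "summable h"
      unfolding h_def summable_complex_of_real using assms(1) d(2) unfolding converges_gt_1_def by blast
    moreover have "norm (of_real (a n) * of_nat n powr (- y) :: complex) \<le> norm (h n)"
      if "y \<in> ball s d" for n y
    proof (cases "n = 0")
      case False
      have "\<bar>Re (s - y)\<bar> < d"
        using that abs_Re_le_cmod[of "s - y"] by (simp add: dist_norm)
      then have "real n powr (- Re y) \<le> real n powr (- (Re s - d))"
        using False by (intro powr_mono) auto
      then show ?thesis
        by (simp add: h_def norm_mult norm_of_nat_powr mult_left_mono)
    qed (simp add: h_def)
    ultimately show "\<exists>d h. 0 < d \<and> summable h \<and> range h \<subseteq> \<real>\<^sub>\<ge>\<^sub>0 \<and>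
        (\<forall>\<^sub>F n in sequentially. \<forall>y\<in>ball s d \<inter> ?S. cmod (of_real (a n) * of_nat n powr (- y)) \<le> cmod (h n))"
      using d by (intro exI[of _ d] exI[of _ h]) (auto simp: h_def complex_nonneg_Reals_iff)
  qed
  then obtain g g' where g: "\<And>s. Re s > 1 \<Longrightarrow> (\<lambda>n. of_real (a n) * of_nat n powr (- s)) sums g s"
      "\<And>s. Re s > 1 \<Longrightarrow> (\<lambda>n. - (of_real (ln (real n) * a n) * of_nat n powr (- s))) sums g' s"
      "\<And>s. Re s > 1 \<Longrightarrow> (g has_field_derivative g' s) (at s)"
    by blast
  have "g' s = - dirichlet (\<lambda>n. ln (real n) * a n) s"
    using sums_minus[OF g(2)[OF assms(2)]] by (simp add: dirichlet_def sums_iff)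
  moreover have "dirichlet a s = g s" if "Re s > 1" for s
    using g(1)[OF that] by (simp add: dirichlet_def sums_iff)
  ultimately show ?thesis
    using has_field_derivative_transform_within_open[OF g(3)[OF assms(2)] S] assms(2) by simp
qed

text \<open>Since \<open>ln n \<le> n powr \<delta> / \<delta>\<close>, half of the excess of
  \<open>\<sigma>\<close> over 1 absorbs the logarithm and the exponent stays below -1.\<close>

lemma converges_gt_1_ln_bound:
  assumes "\<And>n. n > 0 \<Longrightarrow> \<bar>a n\<bar> \<le> ln (real n)"
  shows "converges_gt_1 a"
  unfolding converges_gt_1_def
proof safe
  fix \<sigma> :: real assume \<sigma>: "\<sigma> > 1"
  define \<delta> where "\<delta> = (\<sigma> - 1) / 2"
  have \<delta>: "\<delta> > 0" "\<delta> - \<sigma> < -1" using \<sigma> by (simp_all add: \<delta>_def field_simps)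
  show "summable (\<lambda>n. \<bar>a n\<bar> * real n powr (- \<sigma>))"
  proof (rule summable_comparison_test)
    show "summable (\<lambda>n. real n powr (\<delta> - \<sigma>) / \<delta>)"
      using \<delta> by (intro summable_divide) (simp add: summable_real_powr_iff)
    have "\<bar>a n\<bar> * real n powr (- \<sigma>) \<le> real n powr (\<delta> - \<sigma>) / \<delta>" if "n > 0" for n
    proof -
      have "\<bar>a n\<bar> \<le> real n powr \<delta> / \<delta>"
        using assms[OF that] ln_powr_bound[of "real n" \<delta>] that \<delta> by linarith
      then have "\<bar>a n\<bar> * real n powr (- \<sigma>) \<le> real n powr \<delta> / \<delta> * real n powr (- \<sigma>)"
        by (intro mult_right_mono) auto
      also have "\<dots> = real n powr (\<delta> - \<sigma>) / \<delta>"
        by (simp add: powr_diff powr_minus divide_inverse mult_ac)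
      finally show ?thesis .
    qed
    then show "\<exists>N. \<forall>n\<ge>N. norm (\<bar>a n\<bar> * real n powr (- \<sigma>)) \<le> real n powr (\<delta> - \<sigma>) / \<delta>"
      by (intro exI[of _ 1]) simp
  qed
qed

lemma converges_gt_1_mangoldt: "converges_gt_1 mangoldt"
  by (rule converges_gt_1_ln_bound) (simp add: mangoldt_le)

lemma converges_gt_1_ln: "converges_gt_1 (\<lambda>n. ln (real n))"
  by (rule converges_gt_1_ln_bound) simp

lemma converges_gt_1_one: "converges_gt_1 (\<lambda>_. 1)"
  by (simp add: converges_gt_1_def summable_real_powr_iff)

abbreviation zeta_series :: "complex \<Rightarrow> complex" where
  "zeta_series \<equiv> dirichlet (\<lambda>_. 1)"

lemma dirichlet_has_sum:
  assumes "converges_gt_1 a" "Re s > 1"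
  shows "((\<lambda>n. of_real (a n) * of_nat n powr (- s)) has_sum dirichlet a s) {0<..}"
proof -
  have "((\<lambda>n. of_real (a n) * of_nat n powr (- s)) has_sum dirichlet a s) UNIV"
    using dirichlet_summable[OF assms] dirichlet_sums[OF assms] by (rule norm_summable_imp_has_sum)
  then show ?thesis
    by (rule has_sum_cong_neutral[THEN iffD1, rotated -1]) auto
qed

lemma dirichlet_abs_summable:
  assumes "converges_gt_1 a" "Re s > 1"
  shows "(\<lambda>n. norm (of_real (a n) * of_nat n powr (- s) :: complex)) summable_on {0<..}"
  using norm_summable_imp_summable_on[of "\<lambda>n. norm (of_real (a n) * of_nat n powr (- s) :: complex)"]
    dirichlet_summable[OF assms]
  by (auto intro: summable_on_subset_banach)

text \<open>The right-hand side is minus the derivative of the zeta series, so this identifies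
  \<open>dirichlet mangoldt\<close> with - zeta' / zeta. The double series over
  \<open>(d, m)\<close> converges absolutely and may be regrouped by \<open>n = d * m\<close>; the
  inner sum over the divisors of \<open>n\<close> is then \<open>ln n\<close>.\<close>

lemma mangoldt_times_zeta:
  assumes s: "Re s > 1"
  shows "dirichlet mangoldt s * zeta_series s = dirichlet (\<lambda>n. ln (real n)) s"
proof -
  let ?t = "\<lambda>a (n::nat). of_real (a n) * of_nat n powr (- s) :: complex"
  let ?f = "\<lambda>(d, m). ?t mangoldt d * ?t (\<lambda>_. 1) m"
  have 1: "((\<lambda>m. ?f (d, m)) has_sum ?t mangoldt d * zeta_series s) {0<..}" for d
    using has_sum_cmult_right[OF dirichlet_has_sum[OF converges_gt_1_one s], of "?t mangoldt d"] by simp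
  have 2: "((\<lambda>d. ?t mangoldt d * zeta_series s) has_sum dirichlet mangoldt s * zeta_series s) {0<..}"
    by (intro has_sum_cmult_left dirichlet_has_sum converges_gt_1_mangoldt s)
  have "(\<lambda>x. norm (?f x)) summable_on ({0<..} \<times> {0<..})"
    unfolding Infinite_Sum.abs_summable_on_Sigma_iff
  proof (intro conjI ballI)
    fix d :: nat
    show "(\<lambda>m. norm (?f (d, m))) summable_on {0<..}"
      using summable_on_cmult_right[OF dirichlet_abs_summable[OF converges_gt_1_one s], of "norm (?t mangoldt d)"]
      by (simp add: norm_mult)
  next
    have "(\<lambda>d. norm (?t mangoldt d) * (\<Sum>\<^sub>\<infinity>m\<in>{0<..}. norm (?t (\<lambda>_. 1) m))) summable_on {0<..}"
      by (intro summable_on_cmult_left dirichlet_abs_summable converges_gt_1_mangoldt s)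
    moreover have "(\<Sum>\<^sub>\<infinity>m\<in>{0<..}. norm (?f (d, m))) = norm (?t mangoldt d) * (\<Sum>\<^sub>\<infinity>m\<in>{0<..}. norm (?t (\<lambda>_. 1) m))" for d
      unfolding prod.case norm_mult[of "?t mangoldt d"]
      by (rule infsum_cmult_right) (rule dirichlet_abs_summable[OF converges_gt_1_one s])
    moreover have "(\<Sum>\<^sub>\<infinity>m\<in>{0<..}. norm (?t (\<lambda>_. 1) m)) \<ge> 0"
      by (intro infsum_nonneg) auto
    ultimately show "(\<lambda>d. norm (\<Sum>\<^sub>\<infinity>m\<in>{0<..}. norm (?f (d, m)))) summable_on {0<..}"
      by (simp only: real_norm_def abs_of_nonneg mult_nonneg_nonneg norm_ge_zero)
  qed
  then have "?f summable_on ({0<..} \<times> {0<..})"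
    by (rule abs_summable_summable)
  with 1 2 have "(?f has_sum dirichlet mangoldt s * zeta_series s) ({0<..} \<times> {0<..})"
    by (intro has_sum_SigmaI) auto
  \<comment> \<open>Pairs are reindexed by product and first factor. Restricting to positive numbers
    matters, as 0 has infinitely many divisors.\<close>
  also have "?this \<longleftrightarrow> ((\<lambda>(n, d). ?f (d, n div d)) has_sum dirichlet mangoldt s * zeta_series s)
                (Sigma {0<..} (\<lambda>n. {d. d dvd n}))"
    by (rule has_sum_reindex_bij_witness[of _ "\<lambda>(n, d). (d, n div d)" "\<lambda>(d, m). (d * m, d)"])
       (auto elim!: dvdE intro!: Nat.gr0I)
  finally have "((\<lambda>(n, d). ?f (d, n div d)) has_sum dirichlet mangoldt s * zeta_series s)
                (Sigma {0<..} (\<lambda>n. {d. d dvd n}))" .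
  then have "((\<lambda>n. ?t (\<lambda>n. ln (real n)) n) has_sum dirichlet mangoldt s * zeta_series s) {0<..}"
  proof (rule has_sum_SigmaD)
    fix n :: nat assume n: "n \<in> {0<..}"
    have "?f (d, n div d) = of_real (mangoldt d) * of_nat n powr (- s)" if "d dvd n" for d
    proof -
      have "(of_nat n :: complex) = of_nat d * of_nat (n div d)"
        using that by (simp flip: of_nat_mult)
      then have "(of_nat n powr (- s) :: complex) = of_nat d powr (- s) * of_nat (n div d) powr (- s)"
        by (simp add: powr_times_real)
      then show ?thesis by simp
    qed
    then have "(\<Sum>d | d dvd n. ?f (d, n div d)) = (\<Sum>d | d dvd n. of_real (mangoldt d) * of_nat n powr (- s))"
      by (intro sum.cong) auto
    also have "\<dots> = ?t (\<lambda>n. ln (real n)) n"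
      using mangoldt_sum[of n, where ?'a = complex] n by (simp flip: sum_distrib_right)
    finally show "((\<lambda>d. case (n, d) of (n, d) \<Rightarrow> ?f (d, n div d)) has_sum ?t (\<lambda>n. ln (real n)) n) {d. d dvd n}"
      using n by (intro has_sum_finiteI) (auto intro: finite_divisors_nat)
  qed
  then show ?thesis
    using dirichlet_has_sum[OF converges_gt_1_ln s] by (rule has_sum_unique)
qed

text \<open>
  The continuation of \<open>(s - 1) \<zeta>(s)\<close> to \<open>Re s > 0\<close>: the added telescoping terms have sum \<open>- 1\<close> for
  \<open>Re s > 1\<close> and turn \<open>(s - 1) n\<^sup>-\<^sup>s\<close> into a term of order \<open>n\<^sup>-\<^sup>s\<^sup>-\<^sup>1\<close>.
\<close>

definition zeta_cleared_term :: "nat \<Rightarrow> complex \<Rightarrow> complex" where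
  "zeta_cleared_term n s = (s - 1) * of_nat (Suc n) powr (- s) + (of_nat (Suc (Suc n)) powr (1 - s) - of_nat (Suc n) powr (1 - s))"

definition zeta_cleared :: "complex \<Rightarrow> complex" where
  "zeta_cleared s = 1 + (\<Sum>n. zeta_cleared_term n s)"

text \<open>The term is the increment over \<open>[N, N + 1]\<close> of a function
  \<open>\<phi>\<close> with derivative \<open>(1 - s) * (z powr (- s) - N powr (- s))\<close>,
  which vanishes at \<open>N\<close>. The mean value inequality, first for
  \<open>z powr (- s)\<close> and then for \<open>\<phi>\<close>, produces the factors
  \<open>s\<close> and \<open>s - 1\<close> and the additional power of \<open>N\<close>.\<close>

lemma norm_zeta_cleared_term:
  assumes "Re s > 0"
  shows "norm (zeta_cleared_term n s) \<le> norm (s - 1) * norm s * real (Suc n) powr (- Re s - 1)"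
proof -
  define N where "N = real (Suc n)"
  have N: "N > 0" by (simp add: N_def)
  define \<phi> where "\<phi> = (\<lambda>z::complex. z powr (1 - s) - (1 - s) * of_real N powr (- s) * z)"
  let ?I = "closed_segment (complex_of_real N) (of_real (N + 1))"
  have I: "\<exists>x\<ge>N. z = of_real x" if "z \<in> ?I" for z
    using that unfolding closed_segment_of_real by (auto simp: closed_segment_eq_real_ivl)
  have d1: "norm (z powr (- s) - of_real N powr (- s)) \<le> norm s * N powr (- Re s - 1)" if z: "z \<in> ?I" for z
  proof -
    have "norm (z powr (- s) - of_real N powr (- s)) \<le> norm s * N powr (- Re s - 1) * norm (z - of_real N)"
    proof (rule field_differentiable_bound[where S = ?I])
      fix w assume "w \<in> ?I"
      then obtain x where x: "x \<ge> N" "w = of_real x" using I by blast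
      then show "((\<lambda>z. z powr (- s)) has_field_derivative - s * w powr (- s - 1)) (at w within ?I)"
        using N by (auto intro!: derivative_eq_intros simp: complex_nonpos_Reals_iff)
      have "x powr (- Re s - 1) \<le> N powr (- Re s - 1)"
        using x N assms by (intro powr_mono2') auto
      then show "norm (- s * w powr (- s - 1)) \<le> norm s * N powr (- Re s - 1)"
        using x N by (simp add: norm_mult norm_powr_real_powr mult_left_mono)
    qed (use z in auto)
    also have "norm (z - of_real N) \<le> 1"
      using z segment_bound(1)[of z "complex_of_real N" "of_real (N + 1)"] by (simp add: norm_minus_commute)
    finally show ?thesis
      by (simp add: mult_left_mono)
  qed
  have "norm (\<phi> (of_real (N + 1)) - \<phi> (of_real N)) \<le> norm (s - 1) * norm s * N powr (- Re s - 1) * norm (complex_of_real (N + 1) - of_real N)"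
  proof (rule field_differentiable_bound[where S = ?I])
    fix w assume w: "w \<in> ?I"
    then obtain x where x: "x \<ge> N" "w = of_real x" using I by blast
    then show "(\<phi> has_field_derivative (1 - s) * (w powr (- s) - of_real N powr (- s))) (at w within ?I)"
      using N unfolding \<phi>_def by (auto intro!: derivative_eq_intros simp: complex_nonpos_Reals_iff algebra_simps)
    show "norm ((1 - s) * (w powr (- s) - of_real N powr (- s))) \<le> norm (s - 1) * norm s * N powr (- Re s - 1)"
      using d1[OF w] by (simp add: norm_mult norm_minus_commute mult_left_mono mult.assoc)
  qed auto
  also have "\<phi> (of_real (N + 1)) - \<phi> (of_real N) = zeta_cleared_term n s"
    by (simp add: \<phi>_def zeta_cleared_term_def N_def algebra_simps)
  finally show ?thesis
    by (simp add: N_def)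
qed

lemma zeta_cleared_holomorphic: "zeta_cleared holomorphic_on {s. Re s > 0}"
proof -
  let ?S = "{s. Re s > 0}"
  have S: "open ?S"
    by (simp add: open_halfspace_Re_gt)
  have "\<exists>g. \<forall>s\<in>?S. (\<lambda>n. zeta_cleared_term n s) sums g s \<and> g field_differentiable (at s)"
  proof (rule series_differentiable_comparison_complex[OF S, of zeta_cleared_term])
    fix n s
    have "zeta_cleared_term n holomorphic_on UNIV"
      unfolding zeta_cleared_term_def of_nat_Suc by (intro holomorphic_intros)
    then show "zeta_cleared_term n field_differentiable (at s)"
      by (auto simp: holomorphic_on_def)
  next
    fix s :: complex assume s: "s \<in> ?S"
    \<comment> \<open>On \<open>ball s d\<close> the real part stays above \<open>d\<close>, and
      \<open>M\<close> bounds both \<open>norm y\<close> and \<open>norm (y - 1)\<close>; this makes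
      the preceding estimate uniform.\<close>
    define d where "d = Re s / 2"
    define M where "M = norm s + d + 1"
    have d: "d > 0" using s by (simp add: d_def)
    define h where "h = (\<lambda>n. complex_of_real (M * M * real (Suc n) powr (- d - 1)))"
    have "summable (\<lambda>n. real (Suc n) powr (- d - 1))"
      using d by (subst summable_Suc_iff) (simp add: summable_real_powr_iff)
    then have "summable h"
      unfolding h_def summable_complex_of_real by (intro summable_mult)
    moreover have "norm (zeta_cleared_term n y) \<le> norm (h n)" if y: "y \<in> ball s d" "Re y > 0" for n y
    proof -
      have "norm (y - s) < d"
        using y by (simp add: dist_norm norm_minus_commute)
      then have *: "Re y \<ge> d" "norm y \<le> M" "norm (y - 1) \<le> M"
        using abs_Re_le_cmod[of "y - s"] norm_triangle_sub[of y s] norm_triangle_ineq4[of y 1]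
        by (auto simp: d_def M_def)
      have "norm (zeta_cleared_term n y) \<le> norm (y - 1) * norm y * real (Suc n) powr (- Re y - 1)"
        by (rule norm_zeta_cleared_term[OF y(2)])
      also have "\<dots> \<le> M * M * real (Suc n) powr (- d - 1)"
        using * d by (intro mult_mono powr_mono) (auto simp: M_def)
      finally show ?thesis
        by (simp add: h_def norm_mult)
    qed
    moreover have "M \<ge> 0" using d by (simp add: M_def)
    ultimately show "\<exists>d h. 0 < d \<and> summable h \<and> range h \<subseteq> \<real>\<^sub>\<ge>\<^sub>0 \<and>
        (\<forall>\<^sub>F n in sequentially. \<forall>y\<in>ball s d \<inter> ?S. cmod (zeta_cleared_term n y) \<le> cmod (h n))"
      using d by (intro exI[of _ d] exI[of _ h]) (auto simp: h_def complex_nonneg_Reals_iff)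
  qed blast
  then obtain g where g: "\<forall>s\<in>?S. (\<lambda>n. zeta_cleared_term n s) sums g s \<and> g field_differentiable (at s)" ..
  have "(\<lambda>s. 1 + g s) holomorphic_on ?S"
    using g S by (intro holomorphic_intros) (auto simp: holomorphic_on_open field_differentiable_def)
  then show ?thesis
    by (rule holomorphic_transform) (use g in \<open>auto simp: zeta_cleared_def sums_iff\<close>)
qed

lemma zeta_cleared_1: "zeta_cleared 1 = 1"
proof -
  have "zeta_cleared_term n 1 = 0" for n
    by (simp add: zeta_cleared_term_def del: of_nat_Suc)
  then show ?thesis
    by (simp add: zeta_cleared_def)
qed

lemma zeta_cleared_eq_zeta:
  assumes s: "Re s > 1"
  shows "zeta_cleared s = (s - 1) * zeta_series s"
proof -
  have "(\<lambda>n. of_nat n powr (- s)) sums zeta_series s"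
    using dirichlet_sums[OF converges_gt_1_one s] by simp
  then have "(\<lambda>n. of_nat (Suc n) powr (- s)) sums zeta_series s"
    by (subst sums_Suc_iff) simp
  then have 1: "(\<lambda>n. (s - 1) * of_nat (Suc n) powr (- s)) sums ((s - 1) * zeta_series s)"
    by (rule sums_mult)
  have "(\<lambda>n. of_nat (Suc n) powr (1 - s) :: complex) \<longlonglongrightarrow> 0"
    using s by (intro tendsto_neg_powr_complex_of_nat filterlim_Suc) auto
  from telescope_sums[OF this]
  have 2: "(\<lambda>n. of_nat (Suc (Suc n)) powr (1 - s) - of_nat (Suc n) powr (1 - s)) sums (- 1 :: complex)"
    by simp
  from sums_add[OF 1 2] show ?thesis
    unfolding zeta_cleared_def zeta_cleared_term_def by (simp add: sums_iff)
qed

lemma zeta_cleared_deriv_eq: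
  assumes s: "Re s > 1"
  shows "(s - 1) * deriv zeta_cleared s = zeta_cleared s * (1 - (s - 1) * dirichlet mangoldt s)"
proof -
  have "(zeta_series has_field_derivative - (dirichlet mangoldt s * zeta_series s)) (at s)"
    using dirichlet_deriv[OF converges_gt_1_one s] mangoldt_times_zeta[OF s] by simp
  then have "((\<lambda>s. (s - 1) * zeta_series s) has_field_derivative
               zeta_series s - (s - 1) * (dirichlet mangoldt s * zeta_series s)) (at s)"
    by (auto intro!: derivative_eq_intros)
  then have "(zeta_cleared has_field_derivative
               zeta_series s - (s - 1) * (dirichlet mangoldt s * zeta_series s)) (at s)"
    by (rule has_field_derivative_transform_within_open[of _ _ _ "{s. Re s > 1}"])
       (use s zeta_cleared_eq_zeta in \<open>auto simp: open_halfspace_Re_gt\<close>)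
  then have deriv: "deriv zeta_cleared s = zeta_series s - (s - 1) * (dirichlet mangoldt s * zeta_series s)"
    by (rule DERIV_imp_deriv)
  show ?thesis
    unfolding deriv zeta_cleared_eq_zeta[OF s] by (simp add: algebra_simps)
qed

lemma zeta_cleared_log_deriv:
  assumes s: "Re s > 1" and nz: "zeta_cleared s \<noteq> 0"
  shows "deriv zeta_cleared s / zeta_cleared s = 1 / (s - 1) - dirichlet mangoldt s"
proof -
  have "s - 1 \<noteq> 0" using s by auto
  moreover from this have "deriv zeta_cleared s / zeta_cleared s = (1 - (s - 1) * dirichlet mangoldt s) / (s - 1)"
    using zeta_cleared_deriv_eq[OF s] nz by (simp add: frac_eq_eq mult.commute)
  ultimately show ?thesis
    by (simp add: diff_divide_distrib)
qed

section \<open>Residues of logarithmic derivatives and non-vanishing of zeta\<close>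

lemma holomorphic_on_isCont:
  assumes "f holomorphic_on S" "open S" "z \<in> S"
  shows "isCont f z"
  using assms continuous_on_eq_continuous_at holomorphic_on_imp_continuous_on by blast

text \<open>The number \<open>m\<close> is the order of the zero at \<open>\<xi>\<close>: if
  \<open>f = (z - \<xi>) ^ n * g\<close> with \<open>g\<close> zero-free, the logarithmic derivative
  is \<open>n / (z - \<xi>)\<close> plus a function continuous at \<open>\<xi>\<close>. The point
  \<open>w\<close> rules out that \<open>f\<close> vanishes identically.\<close>

lemma log_deriv_limit:
  assumes f: "f holomorphic_on S" "open S" "connected S" "\<xi> \<in> S" and nz: "w \<in> S" "f w \<noteq> 0"
  shows "\<exists>m::nat. ((\<lambda>z. (z - \<xi>) * (deriv f z / f z)) \<longlongrightarrow> of_nat m) (at \<xi>) \<and> (m = 0 \<longleftrightarrow> f \<xi> \<noteq> 0)"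
proof (cases "f \<xi> = 0")
  case False
  have "isCont f \<xi>" "isCont (deriv f) \<xi>"
    using f by (auto intro: holomorphic_on_isCont holomorphic_deriv)
  then have "((\<lambda>z. (z - \<xi>) * (deriv f z / f z)) \<longlongrightarrow> (\<xi> - \<xi>) * (deriv f \<xi> / f \<xi>)) (at \<xi>)"
    using False unfolding isCont_def by (intro tendsto_intros) auto
  then show ?thesis
    using False by (intro exI[of _ 0]) simp
next
  case True
  then have "\<not> f constant_on S"
    using f(4) nz by (metis constant_on_def)
  then obtain g r n where g: "0 < n" "0 < r" "ball \<xi> r \<subseteq> S" "g holomorphic_on ball \<xi> r"
      "\<And>w. w \<in> ball \<xi> r \<Longrightarrow> f w = (w - \<xi>) ^ n * g w" "\<And>w. w \<in> ball \<xi> r \<Longrightarrow> g w \<noteq> 0"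
    using holomorphic_factor_zero_nonconstant[OF f True] by metis
  have \<xi>: "\<xi> \<in> ball \<xi> r" using g by simp
  have "isCont g \<xi>" "isCont (deriv g) \<xi>"
    using holomorphic_on_isCont[OF g(4) open_ball \<xi>]
      holomorphic_on_isCont[OF holomorphic_deriv[OF g(4) open_ball] open_ball \<xi>] by auto
  then have lim: "((\<lambda>z. of_nat n + (z - \<xi>) * (deriv g z / g z)) \<longlongrightarrow> of_nat n + (\<xi> - \<xi>) * (deriv g \<xi> / g \<xi>)) (at \<xi>)"
    using g(6)[OF \<xi>] unfolding isCont_def by (intro tendsto_intros) auto
  have eq: "(z - \<xi>) * (deriv f z / f z) = of_nat n + (z - \<xi>) * (deriv g z / g z)"
    if z: "z \<in> ball \<xi> r" "z \<noteq> \<xi>" for z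
  proof -
    have "(g has_field_derivative deriv g z) (at z)"
      using g(4) z by (intro holomorphic_derivI[of _ "ball \<xi> r"]) auto
    then have "((\<lambda>w. (w - \<xi>) ^ n * g w) has_field_derivative
           of_nat n * (z - \<xi>) ^ (n - 1) * g z + (z - \<xi>) ^ n * deriv g z) (at z)"
      by (auto intro!: derivative_eq_intros)
    then have "(f has_field_derivative
           of_nat n * (z - \<xi>) ^ (n - 1) * g z + (z - \<xi>) ^ n * deriv g z) (at z)"
      by (rule has_field_derivative_transform_within_open[of _ _ _ "ball \<xi> r"]) (use g z in auto)
    then have "deriv f z = of_nat n * (z - \<xi>) ^ (n - 1) * g z + (z - \<xi>) ^ n * deriv g z"
      by (rule DERIV_imp_deriv)
    moreover have "f z = (z - \<xi>) * (z - \<xi>) ^ (n - 1) * g z"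
      using g(1) g(5)[OF z(1)] by (simp flip: power_Suc)
    moreover have "(z - \<xi>) ^ n = (z - \<xi>) * (z - \<xi>) ^ (n - 1)"
      using g(1) by (simp flip: power_Suc)
    moreover have "u * ((k * p * c + u * p * c') / (u * p * c)) = k + u * (c' / c)"
      if "u \<noteq> 0" "p \<noteq> 0" "c \<noteq> 0" for u p c c' k :: complex
      using that by (simp add: field_simps)
    ultimately show ?thesis
      using g(6)[OF z(1)] z(2) by simp
  qed
  have "((\<lambda>z. of_nat n + (z - \<xi>) * (deriv g z / g z)) \<longlongrightarrow> of_nat n) (at \<xi>)"
    using lim by simp
  from Lim_transform_within_open[OF this open_ball \<xi> eq[symmetric]]
  have "((\<lambda>z. (z - \<xi>) * (deriv f z / f z)) \<longlongrightarrow> of_nat n) (at \<xi>)" .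
  then show ?thesis
    using g(1) True by (intro exI[of _ n]) simp
qed

lemma zeta_cleared_log_deriv_limit:
  assumes "Re \<xi> > 0"
  shows "\<exists>m::nat. ((\<lambda>z. (z - \<xi>) * (deriv zeta_cleared z / zeta_cleared z)) \<longlongrightarrow> of_nat m) (at \<xi>) \<and> (m = 0 \<longleftrightarrow> zeta_cleared \<xi> \<noteq> 0)"
  using assms zeta_cleared_1
  by (intro log_deriv_limit[OF zeta_cleared_holomorphic, of \<xi> 1])
     (auto simp: open_halfspace_Re_gt convex_connected convex_halfspace_Re_gt)

text \<open>A zero would give the logarithmic derivative a nonzero residue at \<open>s\<close>, but
  it agrees nearby with \<open>1 / (z - 1) - dirichlet mangoldt z\<close>, which is continuous
  there.\<close>

lemma zeta_cleared_nonzero_gt_1: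
  assumes s: "Re s > 1"
  shows "zeta_cleared s \<noteq> 0"
proof
  assume 0: "zeta_cleared s = 0"
  obtain m :: nat where m: "((\<lambda>z. (z - s) * (deriv zeta_cleared z / zeta_cleared z)) \<longlongrightarrow> of_nat m) (at s)" "m \<noteq> 0"
    using zeta_cleared_log_deriv_limit[of s] s 0 by auto
  have "isCont (dirichlet mangoldt) s"
    using dirichlet_deriv[OF converges_gt_1_mangoldt s] by (rule DERIV_isCont)
  then have lim: "((\<lambda>z. (z - s) * (1 / (z - 1) - dirichlet mangoldt z)) \<longlongrightarrow>
           (s - s) * (1 / (s - 1) - dirichlet mangoldt s)) (at s)"
    using s unfolding isCont_def by (intro tendsto_intros) auto
  have ev: "\<forall>\<^sub>F z in at s. (z - s) * (1 / (z - 1) - dirichlet mangoldt z) = (z - s) * (deriv zeta_cleared z / zeta_cleared z)"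
  proof -
    have "\<forall>\<^sub>F z in at s. z \<in> {z. Re z > 1}"
      by (rule eventually_at_in_open') (use s in \<open>auto simp: open_halfspace_Re_gt\<close>)
    \<comment> \<open>Since division by 0 yields 0, a nonzero value of this product certifies
      \<open>zeta_cleared z \<noteq> 0\<close>, as \<open>zeta_cleared_log_deriv\<close>
      requires.\<close>
    moreover have "\<forall>\<^sub>F z in at s. (z - s) * (deriv zeta_cleared z / zeta_cleared z) \<noteq> 0"
      using tendsto_imp_eventually_ne[OF m(1), of 0] m(2) by simp
    ultimately show ?thesis
      by eventually_elim (auto simp: zeta_cleared_log_deriv)
  qed
  have "((\<lambda>z. (z - s) * (deriv zeta_cleared z / zeta_cleared z)) \<longlongrightarrow> 0) (at s)"
    using Lim_transform_eventually[OF lim ev] by simp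
  with m show False
    by (metis of_nat_eq_0_iff tendsto_unique trivial_limit_at)
qed

text \<open>The limit is the residue of - zeta' / zeta at \<open>\<xi>\<close>, taken from the
  right: the pole of zeta at 1 counts \<open>+ 1\<close>, a zero of order \<open>m\<close> counts
  \<open>- m\<close>.\<close>

lemma mangoldt_dirichlet_limit:
  assumes \<xi>: "Re \<xi> = 1"
  shows "\<exists>m::nat. ((\<lambda>\<epsilon>::real. of_real \<epsilon> * dirichlet mangoldt (\<xi> + of_real \<epsilon>)) \<longlongrightarrow>
      (if \<xi> = 1 then 1 else 0) - of_nat m) (at_right 0) \<and> (m = 0 \<longleftrightarrow> zeta_cleared \<xi> \<noteq> 0)"
proof -
  obtain m :: nat where m: "((\<lambda>z. (z - \<xi>) * (deriv zeta_cleared z / zeta_cleared z)) \<longlongrightarrow> of_nat m) (at \<xi>)" "m = 0 \<longleftrightarrow> zeta_cleared \<xi> \<noteq> 0"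
    using zeta_cleared_log_deriv_limit[of \<xi>] \<xi> by auto
  have "((\<lambda>\<epsilon>::real. \<xi> + of_real \<epsilon>) \<longlongrightarrow> \<xi> + of_real 0) (at_right 0)"
    by (intro tendsto_intros)
  then have flt: "filterlim (\<lambda>\<epsilon>::real. \<xi> + of_real \<epsilon>) (at \<xi>) (at_right 0)"
    by (auto simp: filterlim_at intro!: eventually_at_rightI[of 0 1])
  from filterlim_compose[OF m(1) flt]
  have l1: "((\<lambda>\<epsilon>::real. of_real \<epsilon> * (deriv zeta_cleared (\<xi> + of_real \<epsilon>) / zeta_cleared (\<xi> + of_real \<epsilon>))) \<longlongrightarrow> of_nat m) (at_right 0)"
    by simp
  have l2: "((\<lambda>\<epsilon>::real. of_real \<epsilon> / (\<xi> + of_real \<epsilon> - 1)) \<longlongrightarrow> (if \<xi> = 1 then 1 else 0 :: complex)) (at_right 0)"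
  proof (cases "\<xi> = 1")
    case True
    then show ?thesis
      by (auto intro!: tendsto_eventually eventually_at_rightI[of 0 1])
  next
    case False
    then have "((\<lambda>\<epsilon>::real. of_real \<epsilon> / (\<xi> + of_real \<epsilon> - 1)) \<longlongrightarrow> of_real 0 / (\<xi> + of_real 0 - 1)) (at_right 0)"
      by (intro tendsto_intros) auto
    with False show ?thesis by simp
  qed
  from tendsto_diff[OF l2 l1]
  have "((\<lambda>\<epsilon>::real. of_real \<epsilon> * dirichlet mangoldt (\<xi> + of_real \<epsilon>)) \<longlongrightarrow>
      (if \<xi> = 1 then 1 else 0) - of_nat m) (at_right 0)"
  proof (rule Lim_transform_eventually)
    show "\<forall>\<^sub>F \<epsilon>::real in at_right 0. of_real \<epsilon> / (\<xi> + of_real \<epsilon> - 1)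
             - of_real \<epsilon> * (deriv zeta_cleared (\<xi> + of_real \<epsilon>) / zeta_cleared (\<xi> + of_real \<epsilon>))
             = of_real \<epsilon> * dirichlet mangoldt (\<xi> + of_real \<epsilon>)"
    proof (rule eventually_at_rightI[of 0 1])
      fix \<epsilon> :: real assume "\<epsilon> \<in> {0<..<1}"
      then have "Re (\<xi> + of_real \<epsilon>) > 1" using \<xi> by simp
      from zeta_cleared_log_deriv[OF this zeta_cleared_nonzero_gt_1[OF this]] show "of_real \<epsilon> / (\<xi> + of_real \<epsilon> - 1)
             - of_real \<epsilon> * (deriv zeta_cleared (\<xi> + of_real \<epsilon>) / zeta_cleared (\<xi> + of_real \<epsilon>))
             = of_real \<epsilon> * dirichlet mangoldt (\<xi> + of_real \<epsilon>)"
        by (simp only: right_diff_distrib times_divide_eq_right mult_1_right diff_diff_eq2 add_diff_cancel_left')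
    qed simp
  qed
  with m(2) show ?thesis by blast
qed

text \<open>The real part of \<open>n powr (- (\<sigma> + \<i> * u))\<close> is
  \<open>n powr (- \<sigma>) * cos (u * ln n)\<close>. With \<open>x = t * ln n\<close>, every term
  carries the factor \<open>3 + 4 * cos x + cos (2 * x)\<close>, which is
  \<open>2 * (1 + cos x)^2\<close>.\<close>

lemma mangoldt_341:
  assumes \<sigma>: "\<sigma> > 1"
  shows "0 \<le> 3 * Re (dirichlet mangoldt (of_real \<sigma>)) + 4 * Re (dirichlet mangoldt (Complex \<sigma> t))
            + Re (dirichlet mangoldt (Complex \<sigma> (2 * t)))"
proof -
  have s: "(\<lambda>n. mangoldt n * real n powr (- \<sigma>) * cos (u * ln (real n))) sums Re (dirichlet mangoldt (Complex \<sigma> u))" for u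
  proof -
    have eq: "Re (of_nat n powr (- Complex \<sigma> u)) = real n powr (- \<sigma>) * cos (u * ln (real n))" for n
      by (cases "n = 0") (auto simp: powr_def Re_exp Ln_of_nat)
    show ?thesis
      using sums_Re[OF dirichlet_sums[OF converges_gt_1_mangoldt, of "Complex \<sigma> u"]] \<sigma>
      by (simp add: eq mult.assoc)
  qed
  have s0: "(\<lambda>n. mangoldt n * real n powr (- \<sigma>)) sums Re (dirichlet mangoldt (of_real \<sigma>))"
    using s[of 0] by (simp add: complex_of_real_def)
  have S: "(\<lambda>n. 3 * (mangoldt n * real n powr (- \<sigma>)) + 4 * (mangoldt n * real n powr (- \<sigma>) * cos (t * ln (real n)))
           + mangoldt n * real n powr (- \<sigma>) * cos (2 * t * ln (real n)))
        sums (3 * Re (dirichlet mangoldt (of_real \<sigma>)) + 4 * Re (dirichlet mangoldt (Complex \<sigma> t))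
            + Re (dirichlet mangoldt (Complex \<sigma> (2 * t))))"
    by (intro sums_add sums_mult s s0)
  have "0 \<le> 3 * (mangoldt n * real n powr (- \<sigma>)) + 4 * (mangoldt n * real n powr (- \<sigma>) * cos (t * ln (real n)))
           + mangoldt n * real n powr (- \<sigma>) * cos (2 * t * ln (real n))" for n
  proof -
    have "3 + 4 * cos x + cos (2 * x) = 2 * (1 + cos x)\<^sup>2" for x :: real
      by (subst cos_double_cos) (simp add: power2_eq_square algebra_simps)
    then have "0 \<le> mangoldt n * real n powr (- \<sigma>) * (3 + 4 * cos (t * ln (real n)) + cos (2 * (t * ln (real n))))"
      by (simp add: mangoldt_nonneg)
    then show ?thesis
      by (simp add: algebra_simps)
  qed
  from sums_le[OF this sums_zero S] show ?thesis .
qed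

lemma zeta_cleared_nonzero:
  assumes "Re s \<ge> 1"
  shows "zeta_cleared s \<noteq> 0"
proof (cases "Re s > 1 \<or> s = 1")
  case True
  then show ?thesis using zeta_cleared_nonzero_gt_1 zeta_cleared_1 by auto
next
  case False
  define t where "t = Im s"
  have s: "s = Complex 1 t" and t: "t \<noteq> 0"
    using assms False by (auto simp: t_def complex_eq_iff)
  obtain m0 :: nat where m0: "((\<lambda>\<epsilon>::real. of_real \<epsilon> * dirichlet mangoldt (1 + of_real \<epsilon>)) \<longlongrightarrow> 1 - of_nat m0) (at_right 0)"
      "m0 = 0 \<longleftrightarrow> zeta_cleared 1 \<noteq> 0"
    using mangoldt_dirichlet_limit[of 1] by auto
  obtain m1 :: nat where m1: "((\<lambda>\<epsilon>::real. of_real \<epsilon> * dirichlet mangoldt (Complex 1 t + of_real \<epsilon>)) \<longlongrightarrow> - of_nat m1) (at_right 0)"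
      "m1 = 0 \<longleftrightarrow> zeta_cleared s \<noteq> 0"
    using mangoldt_dirichlet_limit[of "Complex 1 t"] t s by (auto simp: complex_eq_iff)
  obtain m2 :: nat where m2: "((\<lambda>\<epsilon>::real. of_real \<epsilon> * dirichlet mangoldt (Complex 1 (2 * t) + of_real \<epsilon>)) \<longlongrightarrow> - of_nat m2) (at_right 0)"
    using mangoldt_dirichlet_limit[of "Complex 1 (2 * t)"] t by (auto simp: complex_eq_iff)
  have lim: "((\<lambda>\<epsilon>::real. 3 * Re (of_real \<epsilon> * dirichlet mangoldt (1 + of_real \<epsilon>))
             + 4 * Re (of_real \<epsilon> * dirichlet mangoldt (Complex 1 t + of_real \<epsilon>))
             + Re (of_real \<epsilon> * dirichlet mangoldt (Complex 1 (2 * t) + of_real \<epsilon>))) \<longlongrightarrow>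
           3 * Re (1 - of_nat m0) + 4 * Re (- of_nat m1) + Re (- of_nat m2)) (at_right 0)"
    by (intro tendsto_add tendsto_mult tendsto_const tendsto_Re m0 m1 m2)
  have "0 \<le> 3 * Re (1 - of_nat m0) + 4 * Re (- of_nat m1) + Re (- of_nat m2)"
  proof (rule tendsto_lowerbound[OF lim])
    show "\<forall>\<^sub>F \<epsilon>::real in at_right 0. 0 \<le> 3 * Re (of_real \<epsilon> * dirichlet mangoldt (1 + of_real \<epsilon>))
             + 4 * Re (of_real \<epsilon> * dirichlet mangoldt (Complex 1 t + of_real \<epsilon>))
             + Re (of_real \<epsilon> * dirichlet mangoldt (Complex 1 (2 * t) + of_real \<epsilon>))"
    proof (rule eventually_at_rightI[of 0 1])
      fix \<epsilon> :: real assume \<epsilon>: "\<epsilon> \<in> {0<..<1}"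
      have e: "Re (of_real \<epsilon> * w) = \<epsilon> * Re w" "Complex 1 u + of_real \<epsilon> = Complex (1 + \<epsilon>) u"
          "1 + of_real \<epsilon> = complex_of_real (1 + \<epsilon>)" for w u
        by (simp_all add: complex_eq_iff)
      have "0 \<le> \<epsilon> * (3 * Re (dirichlet mangoldt (of_real (1 + \<epsilon>))) + 4 * Re (dirichlet mangoldt (Complex (1 + \<epsilon>) t))
            + Re (dirichlet mangoldt (Complex (1 + \<epsilon>) (2 * t))))"
        using \<epsilon> by (intro mult_nonneg_nonneg mangoldt_341) auto
      then show "0 \<le> 3 * Re (of_real \<epsilon> * dirichlet mangoldt (1 + of_real \<epsilon>))
             + 4 * Re (of_real \<epsilon> * dirichlet mangoldt (Complex 1 t + of_real \<epsilon>))
             + Re (of_real \<epsilon> * dirichlet mangoldt (Complex 1 (2 * t) + of_real \<epsilon>))"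
        unfolding e by (simp only: distrib_left mult.left_commute[of \<epsilon>])
    qed simp
  qed simp
  \<comment> \<open>As \<open>m0 = 0\<close>, the inequality reads
    \<open>4 * m1 + m2 \<le> 3\<close>, which forces the natural number \<open>m1\<close> to be
    0.\<close>
  then show ?thesis
    using m0(2) m1(2) zeta_cleared_1 by auto
qed

section \<open>The Laplace transform of \<open>\<psi>\<close>\<close>

text \<open>Kept as an integral because the closed form has a denominator \<open>w\<close>, whereas
  the function is entire and its value at \<open>w = 0\<close> is needed at the end.\<close>

definition exp_integral :: "real \<Rightarrow> real \<Rightarrow> complex \<Rightarrow> complex" where
  "exp_integral a b w = integral {a..b} (\<lambda>t. exp (- (w * of_real t)))"

lemma exp_integral_holomorphic: "exp_integral a b holomorphic_on UNIV"
proof -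
  have "(\<lambda>w. integral (cbox a b) (\<lambda>t. exp (- (w * of_real t)))) holomorphic_on UNIV"
  proof (rule leibniz_rule_holomorphic)
    fix w :: complex and t :: real
    show "((\<lambda>w. exp (- (w * of_real t))) has_field_derivative - of_real t * exp (- (w * of_real t))) (at w within UNIV)"
      by (auto intro!: derivative_eq_intros)
    show "(\<lambda>t. exp (- (w * complex_of_real t))) integrable_on cbox a b"
      by (intro integrable_continuous continuous_intros)
    show "continuous_on (UNIV \<times> cbox a b) (\<lambda>(w, t). - complex_of_real t * exp (- (w * of_real t)))"
      by (auto simp: case_prod_unfold intro!: continuous_intros)
  qed auto
  then show ?thesis
    by (simp add: exp_integral_def [abs_def])
qed

lemma has_integral_exp_integral:
  "((\<lambda>t. exp (- (w * of_real t))) has_integral exp_integral a b w) {a..b}"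
  unfolding exp_integral_def
  by (intro integrable_integral integrable_continuous_real continuous_intros)

lemma exp_integral_eq:
  assumes "w \<noteq> 0" "a \<le> b"
  shows "exp_integral a b w = (exp (- (w * of_real a)) - exp (- (w * of_real b))) / w"
proof -
  have "((\<lambda>t. exp (- (w * of_real t))) has_integral
          (- exp (- (w * of_real b)) / w) - (- exp (- (w * of_real a)) / w)) {a..b}"
  proof (rule fundamental_theorem_of_calculus[OF \<open>a \<le> b\<close>])
    fix t
    have "((\<lambda>t. - exp (- (w * t)) / w) has_field_derivative exp (- (w * of_real t))) (at (of_real t))"
      using \<open>w \<noteq> 0\<close> by (auto intro!: derivative_eq_intros)
    then show "((\<lambda>t. - exp (- (w * complex_of_real t)) / w) has_vector_derivative exp (- (w * of_real t))) (at t within {a..b})"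
      using has_vector_derivative_real_field by blast
  qed
  then show ?thesis
    unfolding exp_integral_def by (simp add: integral_unique diff_divide_distrib)
qed

lemma exp_integral_0: "a \<le> b \<Longrightarrow> exp_integral a b 0 = of_real (b - a)"
  by (simp add: exp_integral_def scaleR_conv_of_real)

lemma has_integral_exp_real:
  fixes c :: real
  assumes "c \<noteq> 0" "a \<le> b"
  shows "((\<lambda>t. exp (- (c * t))) has_integral (exp (- (c * a)) - exp (- (c * b))) / c) {a..b}"
proof -
  have "((\<lambda>t. exp (- (c * t))) has_integral (- exp (- (c * b)) / c) - (- exp (- (c * a)) / c)) {a..b}"
    using assms by (intro fundamental_theorem_of_calculus)
      (auto intro!: derivative_eq_intros simp flip: has_real_derivative_iff_has_vector_derivative)
  then show ?thesis
    by (simp add: diff_divide_distrib)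
qed

section \<open>The truncated transform and its bounds\<close>

definition psi_defect :: "real \<Rightarrow> real" where
  "psi_defect t = chebyshev_psi (exp t) * exp (- t) - 1"

lemma psi_defect_bound: "\<bar>psi_defect t\<bar> \<le> 4"
proof -
  have "chebyshev_psi (exp t) * exp (- t) \<le> 4 * exp t * exp (- t)"
    by (intro mult_right_mono chebyshev_psi_le) auto
  also have "\<dots> = 4"
    by (simp flip: exp_add)
  finally have "chebyshev_psi (exp t) * exp (- t) \<le> 4" .
  moreover have "0 \<le> chebyshev_psi (exp t) * exp (- t)"
    by (simp add: chebyshev_psi_nonneg)
  ultimately show ?thesis
    by (simp add: psi_defect_def)
qed

text \<open>Since \<open>chebyshev_psi (exp t)\<close> collects the \<open>n\<close> with
  \<open>ln n \<le> t\<close>, exchanging sum and integral leaves for each \<open>n\<close> an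
  integral from \<open>ln n\<close> to \<open>T\<close>; the factor \<open>exp (- t)\<close> in
  \<open>psi_defect\<close> shifts \<open>z\<close> to \<open>z + 1\<close>. In this finite form
  holomorphy is evident.\<close>

definition laplace_psi :: "real \<Rightarrow> complex \<Rightarrow> complex" where
  "laplace_psi T z = (\<Sum>n | real n \<le> exp T. of_real (mangoldt n) * exp_integral (ln (real n)) T (z + 1))
                      - exp_integral 0 T z"

lemma laplace_psi_holomorphic: "laplace_psi T holomorphic_on UNIV"
proof -
  have "(\<lambda>z. exp_integral a b (z + 1)) holomorphic_on UNIV" for a b
    using holomorphic_on_compose[OF _ holomorphic_on_subset[OF exp_integral_holomorphic], of "\<lambda>z. z + 1" UNIV a b]
    by (simp add: o_def holomorphic_intros)
  then show ?thesis
    unfolding laplace_psi_def by (intro holomorphic_intros exp_integral_holomorphic)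
qed

text \<open>The assumption on \<open>t\<close> covers \<open>n = 0\<close>, where
  \<open>ln 0 = 0\<close>.\<close>

lemma ln_of_nat_le_iff:
  assumes "t \<ge> 0"
  shows "ln (real n) \<le> t \<longleftrightarrow> real n \<le> exp t"
  using assms exp_le_cancel_iff[of "ln (real n)" t] by (cases "n = 0") auto

lemma laplace_psi_has_integral:
  assumes T: "T \<ge> 0"
  shows "((\<lambda>t. of_real (psi_defect t) * exp (- (z * of_real t))) has_integral laplace_psi T z) {0..T}"
proof -
  let ?e = "\<lambda>t. exp (- ((z + 1) * complex_of_real t))"
  \<comment> \<open>Each integral is extended by 0 to all of \<open>{0..T}\<close>, so that the sum
    can be evaluated at a fixed \<open>t\<close>, where exactly the \<open>n \<le> exp t\<close>
    survive.\<close>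
  have 1: "((\<lambda>t. of_real (mangoldt n) * (if t \<in> {ln (real n)..T} then ?e t else 0)) has_integral
          of_real (mangoldt n) * exp_integral (ln (real n)) T (z + 1)) {0..T}" for n
  proof (rule has_integral_mult_right)
    have "ln (real n) \<ge> 0" by (cases "n = 0") auto
    then show "((\<lambda>t. if t \<in> {ln (real n)..T} then ?e t else 0) has_integral exp_integral (ln (real n)) T (z + 1)) {0..T}"
      by (subst has_integral_restrict) (auto intro: has_integral_exp_integral)
  qed
  have "((\<lambda>t. (\<Sum>n | real n \<le> exp T. of_real (mangoldt n) * (if t \<in> {ln (real n)..T} then ?e t else 0))
            - exp (- (z * of_real t))) has_integral laplace_psi T z) {0..T}"
    unfolding laplace_psi_def
    by (intro has_integral_diff has_integral_sum 1 has_integral_exp_integral) auto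
  then show ?thesis
  proof (rule has_integral_eq[rotated])
    fix t assume t: "t \<in> {0..T}"
    have S: "(\<Sum>n | real n \<le> exp T. of_real (mangoldt n) * (if t \<in> {ln (real n)..T} then ?e t else 0))
        = of_real (chebyshev_psi (exp t)) * ?e t"
    proof -
      have "(\<Sum>n | real n \<le> exp T. of_real (mangoldt n) * (if t \<in> {ln (real n)..T} then ?e t else 0))
          = (\<Sum>n | real n \<le> exp t. of_real (mangoldt n) * ?e t)"
        using t by (intro sum.mono_neutral_cong_right)
          (auto simp: ln_of_nat_le_iff intro: order.trans[of _ "exp t"])
      then show ?thesis
        by (simp add: chebyshev_psi_def sum_distrib_right)
    qed
    have "- ((z + 1) * of_real t) = of_real (- t) + - (z * of_real t)"
      by (simp add: algebra_simps)
    then have E: "?e t = of_real (exp (- t)) * exp (- (z * of_real t))"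
      by (simp only: exp_add exp_of_real)
    show "(\<Sum>n | real n \<le> exp T. of_real (mangoldt n) * (if t \<in> {ln (real n)..T} then ?e t else 0))
            - exp (- (z * of_real t)) = of_real (psi_defect t) * exp (- (z * of_real t))"
      unfolding S unfolding E
      by (simp add: psi_defect_def algebra_simps)
  qed
qed

text \<open>One estimate for both sides of the imaginary axis: \<open>a = 0\<close> gives the left
  bound for Newman's theorem, and letting \<open>b\<close> tend to infinity gives the right
  one.\<close>

lemma laplace_psi_diff_bound:
  assumes "0 \<le> a" "a \<le> b" "Re z \<noteq> 0"
  shows "norm (laplace_psi b z - laplace_psi a z) \<le> 4 * ((exp (- (Re z * a)) - exp (- (Re z * b))) / Re z)"
proof -
  let ?f = "\<lambda>t. of_real (psi_defect t) * exp (- (z * of_real t))"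
  have int: "?f integrable_on {0..b}"
    using laplace_psi_has_integral[of b z] assms by (auto simp: integrable_on_def)
  have "integral {0..a} ?f + integral {a..b} ?f = integral {0..b} ?f"
    using assms int by (intro Henstock_Kurzweil_Integration.integral_combine) auto
  then have "laplace_psi b z - laplace_psi a z = integral {a..b} ?f"
    using laplace_psi_has_integral[of b z] laplace_psi_has_integral[of a z] assms
    by (simp add: integral_unique algebra_simps)
  also have "norm \<dots> \<le> integral {a..b} (\<lambda>t. 4 * exp (- (Re z * t)))"
  proof (rule integral_norm_bound_integral)
    show "?f integrable_on {a..b}"
      using int by (rule integrable_on_subinterval) (use assms in auto)
    show "(\<lambda>t. 4 * exp (- (Re z * t))) integrable_on {a..b}"
      by (intro integrable_continuous_real continuous_intros)
    show "norm (?f t) \<le> 4 * exp (- (Re z * t))" for t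
      by (simp add: norm_mult psi_defect_bound)
  qed
  also have "\<dots> = 4 * ((exp (- (Re z * a)) - exp (- (Re z * b))) / Re z)"
    using has_integral_mult_right[OF has_integral_exp_real[OF assms(3,2)], of 4]
    by (rule integral_unique)
  finally show ?thesis .
qed

lemma laplace_psi_0: "laplace_psi 0 z = 0"
proof -
  have "((\<lambda>t. of_real (psi_defect t) * exp (- (z * of_real t))) has_integral laplace_psi 0 z) (cbox 0 0)"
    using laplace_psi_has_integral[of 0 z] by (simp only: cbox_interval order.refl)
  from has_integral_unique[OF this has_integral_refl(1)] show ?thesis .
qed

lemma laplace_psi_left_bound:
  assumes "T \<ge> 0" "Re z < 0"
  shows "norm (laplace_psi T z) \<le> 4 * exp (- (T * Re z)) / (- Re z)"
proof -
  have "norm (laplace_psi T z) \<le> 4 * ((exp (- (Re z * 0)) - exp (- (Re z * T))) / Re z)"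
    using laplace_psi_diff_bound[of 0 T z] assms by (simp add: laplace_psi_0)
  also have "\<dots> \<le> 4 * exp (- (T * Re z)) / (- Re z)"
    using assms by (simp add: field_simps)
  finally show ?thesis .
qed

section \<open>The limit of the transform and its holomorphic extension\<close>

lemma filterlim_partial_sums_exp:
  fixes f :: "nat \<Rightarrow> complex"
  assumes "f sums s"
  shows "((\<lambda>T. \<Sum>n | real n \<le> exp T. f n) \<longlongrightarrow> s) at_top"
proof -
  have 1: "filterlim (\<lambda>T::real. nat \<lfloor>exp T\<rfloor>) at_top at_top"
    by (intro filterlim_compose[OF filterlim_nat_sequentially]
        filterlim_compose[OF filterlim_floor_sequentially] exp_at_top)
  have "(\<lambda>n. \<Sum>i\<le>n. f i) \<longlonglongrightarrow> s"
    using assms by (simp add: sums_def_le)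
  from filterlim_compose[OF this 1] have "((\<lambda>T::real. \<Sum>i\<le>nat \<lfloor>exp T\<rfloor>. f i) \<longlongrightarrow> s) at_top" .
  moreover have "{n. real n \<le> exp T} = {..nat \<lfloor>exp T\<rfloor>}" for T
    by (auto simp: le_nat_floor le_nat_iff le_floor_iff)
  ultimately show ?thesis by simp
qed

text \<open>Prepares the limit in \<open>T\<close>: a partial sum of
  \<open>dirichlet mangoldt (z + 1)\<close> is separated from boundary terms. For
  \<open>Re z > 0\<close> these tend to 0, the one with \<open>chebyshev_psi\<close> by Chebyshev's
  bound.\<close>

lemma laplace_psi_eq:
  assumes "T \<ge> 0" "z \<noteq> 0" "z + 1 \<noteq> 0"
  shows "laplace_psi T z = ((\<Sum>n | real n \<le> exp T. of_real (mangoldt n) * of_nat n powr (- (z + 1)))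
            - of_real (chebyshev_psi (exp T)) * exp (- ((z + 1) * of_real T))) / (z + 1)
          - (1 - exp (- (z * of_real T))) / z"
proof -
  have "of_real (mangoldt n) * exp_integral (ln (real n)) T (z + 1)
      = (of_real (mangoldt n) * of_nat n powr (- (z + 1)) - of_real (mangoldt n) * exp (- ((z + 1) * of_real T))) / (z + 1)"
    if "real n \<le> exp T" for n
  proof (cases "n = 0")
    case False
    then have "(of_nat n powr (- (z + 1)) :: complex) = exp (- ((z + 1) * of_real (ln (real n))))"
      by (simp add: powr_def Ln_of_nat algebra_simps)
    then show ?thesis
      using that assms ln_of_nat_le_iff[of T n] by (simp add: exp_integral_eq right_diff_distrib)
  qed simp
  then show ?thesis
    using assms unfolding laplace_psi_def
    by (simp add: exp_integral_eq chebyshev_psi_def sum_subtractf sum_distrib_right flip: sum_divide_distrib)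
qed

lemma laplace_psi_limit:
  assumes z: "Re z > 0"
  shows "((\<lambda>T. laplace_psi T z) \<longlongrightarrow> dirichlet mangoldt (z + 1) / (z + 1) - 1 / z) at_top"
proof -
  have ne: "z \<noteq> 0" "z + 1 \<noteq> 0"
    using z by (auto simp: complex_eq_iff)
  have e0: "((\<lambda>T. exp (- (Re z * T))) \<longlongrightarrow> 0) at_top"
    using z by (intro filterlim_compose[OF exp_at_bot] filterlim_uminus_at_bot_at_top[THEN filterlim_compose]
       filterlim_tendsto_pos_mult_at_top[OF tendsto_const] filterlim_ident)
  have l1: "((\<lambda>T. exp (- (z * of_real T))) \<longlongrightarrow> 0) at_top"
    using e0 by (intro tendsto_norm_zero_cancel[of "\<lambda>T. exp (- (z * of_real T))"]) simp
  have l2: "((\<lambda>T. of_real (chebyshev_psi (exp T)) * exp (- ((z + 1) * of_real T))) \<longlongrightarrow> 0) at_top"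
  proof (rule Lim_null_comparison)
    show "((\<lambda>T. 4 * exp (- (Re z * T))) \<longlongrightarrow> 0) at_top"
      using tendsto_mult[OF tendsto_const e0, of 4] by simp
    have "norm (of_real (chebyshev_psi (exp T)) * exp (- ((z + 1) * of_real T))) \<le> 4 * exp (- (Re z * T))" for T
    proof -
      have "norm (of_real (chebyshev_psi (exp T)) * exp (- ((z + 1) * of_real T))) = chebyshev_psi (exp T) * exp (- ((Re z + 1) * T))"
        by (simp add: norm_mult chebyshev_psi_nonneg)
      also have "\<dots> \<le> 4 * exp T * exp (- ((Re z + 1) * T))"
        by (intro mult_right_mono chebyshev_psi_le) auto
      also have "\<dots> = 4 * exp (- (Re z * T))"
        by (simp add: distrib_right flip: exp_add)
      finally show ?thesis .
    qed
    then show "\<forall>\<^sub>F T in at_top. norm (of_real (chebyshev_psi (exp T)) * exp (- ((z + 1) * of_real T))) \<le> 4 * exp (- (Re z * T))"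
      by (intro always_eventually allI)
  qed
  have "((\<lambda>T. ((\<Sum>n | real n \<le> exp T. of_real (mangoldt n) * of_nat n powr (- (z + 1)))
            - of_real (chebyshev_psi (exp T)) * exp (- ((z + 1) * of_real T))) / (z + 1)
          - (1 - exp (- (z * of_real T))) / z) \<longlongrightarrow> (dirichlet mangoldt (z + 1) - 0) / (z + 1) - (1 - 0) / z) at_top"
    using z by (intro tendsto_diff tendsto_divide tendsto_const l1 l2 filterlim_partial_sums_exp
        dirichlet_sums converges_gt_1_mangoldt ne) auto
  then have "((\<lambda>T. laplace_psi T z) \<longlongrightarrow> (dirichlet mangoldt (z + 1) - 0) / (z + 1) - (1 - 0) / z) at_top"
    by (rule Lim_transform_eventually)
       (use eventually_ge_at_top[of 0] in \<open>eventually_elim, simp add: laplace_psi_eq ne\<close>)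
  then show ?thesis by simp
qed

lemma laplace_psi_right_bound:
  assumes T: "T \<ge> 0" and z: "Re z > 0"
  shows "norm (dirichlet mangoldt (z + 1) / (z + 1) - 1 / z - laplace_psi T z) \<le> 4 * exp (- (T * Re z)) / Re z"
proof (rule tendsto_upperbound)
  show "((\<lambda>b. norm (laplace_psi b z - laplace_psi T z)) \<longlongrightarrow>
          norm (dirichlet mangoldt (z + 1) / (z + 1) - 1 / z - laplace_psi T z)) at_top"
    by (intro tendsto_norm tendsto_diff laplace_psi_limit z tendsto_const)
  show "\<forall>\<^sub>F b in at_top. norm (laplace_psi b z - laplace_psi T z) \<le> 4 * exp (- (T * Re z)) / Re z"
    using eventually_ge_at_top[of T]
  proof eventually_elim
    case (elim b)
    then have "norm (laplace_psi b z - laplace_psi T z) \<le> 4 * ((exp (- (Re z * T)) - exp (- (Re z * b))) / Re z)"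
      using laplace_psi_diff_bound[of T b z] T z by simp
    also have "\<dots> \<le> 4 * exp (- (T * Re z)) / Re z"
      using z by (simp add: field_simps)
    finally show ?case .
  qed
qed simp

text \<open>Write \<open>F\<close> for \<open>zeta_cleared\<close> and \<open>s = z + 1\<close>.
  Inserting \<open>1 / (s - 1) - F' / F\<close> for the von Mangoldt series in
  \<open>dirichlet mangoldt s / s - 1 / (s - 1)\<close> leaves \<open>(- F' / F - 1) / s\<close>:
  the poles at \<open>z = 0\<close> cancel algebraically.\<close>

definition laplace_psi_limit_ext :: "complex \<Rightarrow> complex" where
  "laplace_psi_limit_ext z = (- (deriv zeta_cleared (z + 1) / zeta_cleared (z + 1)) - 1) / (z + 1)"

lemma laplace_psi_limit_ext_eq:
  assumes z: "Re z > 0"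
  shows "laplace_psi_limit_ext z = dirichlet mangoldt (z + 1) / (z + 1) - 1 / z"
proof -
  have ne: "z \<noteq> 0" "z + 1 \<noteq> 0"
    using z by (auto simp: complex_eq_iff)
  have eq: "deriv zeta_cleared (z + 1) / zeta_cleared (z + 1) = 1 / z - dirichlet mangoldt (z + 1)"
    using zeta_cleared_log_deriv[of "z + 1"] zeta_cleared_nonzero[of "z + 1"] z by simp
  have "(- (1 / z - p) - 1) / (z + 1) = p / (z + 1) - 1 / z" for p
    using ne by (simp add: field_simps)
  then show ?thesis
    unfolding laplace_psi_limit_ext_def eq .
qed

lemma laplace_psi_at_0_convergent:
  "((\<lambda>T. laplace_psi T 0) \<longlongrightarrow> laplace_psi_limit_ext 0) at_top"
proof -
  \<comment> \<open>Continuity makes \<open>V\<close> open, and non-vanishing puts the closed half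
    plane \<open>Re s \<ge> 1\<close> inside it; its shift \<open>U\<close> is the neighbourhood
    that Newman's theorem asks for.\<close>
  define V where "V = {s. Re s > 0} \<inter> zeta_cleared -` (- {0})"
  define U where "U = (\<lambda>z. z + 1) -` V"
  have "open V"
    unfolding V_def using zeta_cleared_holomorphic
    by (intro continuous_open_preimage holomorphic_on_imp_continuous_on) (auto simp: open_halfspace_Re_gt)
  have "open U"
    unfolding U_def using \<open>open V\<close> by (intro open_vimage continuous_intros)
  have "(\<lambda>s. deriv zeta_cleared s / zeta_cleared s) holomorphic_on V"
  proof (rule holomorphic_on_divide)
    show "zeta_cleared holomorphic_on V" "deriv zeta_cleared holomorphic_on V"
      using zeta_cleared_holomorphic holomorphic_deriv[OF zeta_cleared_holomorphic]
      by (auto simp: V_def open_halfspace_Re_gt elim!: holomorphic_on_subset)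
  qed (auto simp: V_def)
  then have "(\<lambda>s. deriv zeta_cleared s / zeta_cleared s) holomorphic_on (\<lambda>z. z + 1) ` U"
    by (rule holomorphic_on_subset) (auto simp: U_def)
  moreover have "(\<lambda>z. z + 1) holomorphic_on U"
    by (intro holomorphic_intros)
  ultimately have "(\<lambda>z. deriv zeta_cleared (z + 1) / zeta_cleared (z + 1)) holomorphic_on U"
    using holomorphic_on_compose[of "\<lambda>z. z + 1" U "\<lambda>s. deriv zeta_cleared s / zeta_cleared s"] by (simp add: o_def)
  then have "(\<lambda>z. (- (deriv zeta_cleared (z + 1) / zeta_cleared (z + 1)) - 1) / (z + 1)) holomorphic_on U"
    by (rule holomorphic_on_divide[OF holomorphic_on_diff[OF holomorphic_on_minus]])
       (auto simp: U_def V_def complex_eq_iff intro!: holomorphic_intros)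
  then have hol: "laplace_psi_limit_ext holomorphic_on U"
    by (simp add: laplace_psi_limit_ext_def [abs_def])
  have sub: "{z. Re z \<ge> 0} \<subseteq> U"
    using zeta_cleared_nonzero by (auto simp: U_def V_def)
  show ?thesis
  proof (rule newman_tauberian[OF \<open>open U\<close> sub hol])
    show "norm (laplace_psi_limit_ext z - laplace_psi T z) \<le> 4 * exp (- (T * Re z)) / Re z"
      if "T \<ge> 0" "Re z > 0" for T z
      using laplace_psi_right_bound[OF that] that by (simp add: laplace_psi_limit_ext_eq)
  qed (rule laplace_psi_holomorphic laplace_psi_left_bound; assumption)+
qed

text \<open>With \<open>x = exp T\<close> this is the expression whose convergence
  \<open>chebyshev_psi_asymptotics\<close> assumes; the subtracted \<open>T\<close> comes from
  \<open>exp_integral 0 T 0\<close> and becomes \<open>ln x\<close>.\<close>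

lemma laplace_psi_at_0:
  assumes "T \<ge> 0"
  shows "laplace_psi T 0 = of_real ((\<Sum>n | real n \<le> exp T. mangoldt n / real n) - chebyshev_psi (exp T) / exp T - T)"
proof -
  have "of_real (mangoldt n) * exp_integral (ln (real n)) T (0 + 1)
      = (of_real (mangoldt n / real n - mangoldt n / exp T) :: complex)"
    if "real n \<le> exp T" for n
  proof (cases "n = 0")
    case False
    then have "exp_integral (ln (real n)) T 1 = of_real (exp (- ln (real n)) - exp (- T))"
      using that assms ln_of_nat_le_iff[of T n] by (simp add: exp_integral_eq exp_of_real flip: of_real_minus)
    also have "exp (- ln (real n)) - exp (- T) = 1 / real n - 1 / exp T"
      using False by (simp add: exp_minus field_simps)
    finally show ?thesis
      by (simp add: right_diff_distrib)
  qed simp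
  then show ?thesis
    using assms unfolding laplace_psi_def
    by (simp add: exp_integral_0 chebyshev_psi_def sum_subtractf sum_divide_distrib)
qed

lemma chebyshev_psi_over_x: "((\<lambda>x. chebyshev_psi x / x) \<longlongrightarrow> 1) at_top"
proof (rule chebyshev_psi_asymptotics)
  have "((\<lambda>x. Re (laplace_psi (ln x) 0)) \<longlongrightarrow> Re (laplace_psi_limit_ext 0)) at_top"
    by (intro tendsto_Re filterlim_compose[OF laplace_psi_at_0_convergent ln_at_top])
  then show "((\<lambda>x. (\<Sum>n | real n \<le> x. mangoldt n / real n) - chebyshev_psi x / x - ln x) \<longlongrightarrow>
      Re (laplace_psi_limit_ext 0)) at_top"
    by (rule Lim_transform_eventually)
       (use eventually_ge_at_top[of 1] in \<open>eventually_elim, simp add: laplace_psi_at_0\<close>)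
qed

theorem theorem2p3p1:
  shows "chebyshev_theta \<sim>[at_top] (\<lambda>x::real. x) \<and>
         ((\<lambda>x::real. chebyshev_theta x / x) \<longlongrightarrow> 1) at_top"
proof
  show lim: "((\<lambda>x::real. chebyshev_theta x / x) \<longlongrightarrow> 1) at_top"
    by (intro chebyshev_theta_asymptotics chebyshev_psi_over_x)
  show "chebyshev_theta \<sim>[at_top] (\<lambda>x::real. x)"
    using lim by (rule asymp_equivI')
qed

end
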